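(* Let $X$ be a compact metric space and let $\Phi\colon X\times\mathbb{R}\to X$ be a continuous fixed-point free flow that is expansive and has local product structure. Then $\Phi$ has the pseudo-orbit-tracing property and the orbit closing property.
   Context: Write $\Phi(x,t)=\phi^t(x)$ and let $d$ be the metric of $X$. Fixed-point free: for every $x$ there is $\tau\ne0$ with $\phi^\tau(x)\neq x$. Expansive: for every $\varepsilon>0$ there is $\delta>0$ such that if $x,y\in X$ and there is an increasing homeomorphism $\rho\colon\mathbb{R}\to\mathbb{R}$ with $\rho(0)=0$ and $d(\phi^{\rho(t)}(y),\phi^t(x))\le\delta$ for all $t\in\mathbb{R}$, then $y=\phi^{t(y)}(x)$ for some $|t(y)|\le\varepsilon$. Local product structure: let $\mathscr{W}^{\mathrm s}(\Phi,x)=\{y: d(\phi^t(y),\phi^t(x))\to0\text{ as }t\to\infty\}$ and $\mathscr{W}^{\mathrm s}_\varepsilon(\Phi,x)=\{y\in\mathscr{W}^{\mathrm s}(\Phi,x): d(\phi^t(y),\phi^t(x))\le\varepsilon\ \forall t\ge0\}$, and let $\mathscr{W}^{\mathrm u}_\varepsilon(\Phi,x)$ be $\mathscr{W}^{\mathrm s}_\varepsilon$ of $x$ for the time-reversed flow. $\Phi$ has local product structure if for every $\varepsilon>0$ there is $\delta>0$ such that for all $x,y$ with $d(x,y)\le\delta$ there is a unique $\tau\in\mathbb{R}$ with $|\tau|\le\varepsilon$ such that $\mathscr{W}^{\mathrm s}_\varepsilon(\Phi,\phi^\tau(x))\cap\mathscr{W}^{\mathrm u}_\varepsilon(\Phi,y)$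 is nonempty and consists of a single point. Pseudo-orbit-tracing property: for $T,\delta>0$, a $(\delta,T)$-pseudo orbit is a sequence $(x_k,\tau_k)_{k\in\mathbb{Z}}$ with $x_k\in X$, $\tau_k\ge T$ and $d(\phi^{\tau_k}(x_k),x_{k+1})\le\delta$ for all $k$. Put $s_0=0$, $s_k=\tau_0+\dots+\tau_{k-1}$ and $s_{-k}=\tau_{-k}+\dots+\tau_{-1}$ for $k\ge1$. The pseudo orbit is $\varepsilon$-traced by the orbit of $y$ if there is an increasing continuous injection $\rho\colon\mathbb{R}\to\mathbb{R}$ with continuous inverse, $\rho(0)=0$, such that (1) for $k\ge0$ and $s_k\le s<s_{k+1}$ one has $d(\phi^{\rho(s)}(y),\phi^{s-s_k}(x_k))\le\varepsilon$; (2) for $k\ge1$ and $-s_{-k}\le s<-s_{-k+1}$ one has $d(\phi^{\rho(s)}(y),\phi^{s+s_{-k}}(x_{-k}))\le\varepsilon$. $\Phi$ has the pseudo-orbit-tracing property if for every $\varepsilon>0$ and $T>0$ there is $\delta>0$ such that every $(\delta,T)$-pseudo orbit is $\varepsilon$-traced by an orbit of $\Phi$. Orbit closing property: for every $\varepsilon>0$ there are $\delta>0$ and $T>0$ such that for every $x\in X$ and $t>T$ with $d(x,\phi^t(x))\le\delta$ there are $y\in X$ and $\ell>0$ with $|\ell-t|\le\varepsilon$, $\phi^\ell(y)=y$, and $d(\phi^s(x),\phi^s(y))\le\varepsilon$ for $0\le s\le\min\{t,\ell\}$. *)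

theory Defs
  imports "HOL-Analysis.Analysis"
begin

text \<open>
  A flow on the whole type is written \<open>\<phi> t x\<close> for $\phi^t(x) = \Phi(x,t)$.
\<close>

definition continuous_flow :: "(real \<Rightarrow> 'a::metric_space \<Rightarrow> 'a) \<Rightarrow> bool" where
  "continuous_flow \<phi> \<longleftrightarrow>
     continuous_on UNIV (\<lambda>(x, t). \<phi> t x) \<and>
     (\<forall>x. \<phi> 0 x = x) \<and>
     (\<forall>s t x. \<phi> (s + t) x = \<phi> s (\<phi> t x))"

definition fixed_point_free :: "(real \<Rightarrow> 'a::metric_space \<Rightarrow> 'a) \<Rightarrow> bool" where
  "fixed_point_free \<phi> \<longleftrightarrow> (\<forall>x. \<exists>\<tau>. \<tau> \<noteq> 0 \<and> \<phi> \<tau> x \<noteq> x)"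

definition expansive :: "(real \<Rightarrow> 'a::metric_space \<Rightarrow> 'a) \<Rightarrow> bool" where
  "expansive \<phi> \<longleftrightarrow>
     (\<forall>\<epsilon>>0. \<exists>\<delta>>0. \<forall>x y.
        (\<exists>\<rho> \<rho>' :: real \<Rightarrow> real. homeomorphism UNIV UNIV \<rho> \<rho>' \<and> strict_mono \<rho> \<and> \<rho> 0 = 0 \<and>
           (\<forall>t. dist (\<phi> (\<rho> t) y) (\<phi> t x) \<le> \<delta>)) \<longrightarrow>
        (\<exists>t. \<bar>t\<bar> \<le> \<epsilon> \<and> y = \<phi> t x))"

definition stable_set :: "(real \<Rightarrow> 'a::metric_space \<Rightarrow> 'a) \<Rightarrow> 'a \<Rightarrow> 'a set" where
  "stable_set \<phi> x = {y. ((\<lambda>t. dist (\<phi> t y) (\<phi> t x)) \<longlongrightarrow> 0) at_top}"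

definition local_stable_set :: "(real \<Rightarrow> 'a::metric_space \<Rightarrow> 'a) \<Rightarrow> real \<Rightarrow> 'a \<Rightarrow> 'a set" where
  "local_stable_set \<phi> \<epsilon> x = {y \<in> stable_set \<phi> x. \<forall>t\<ge>0. dist (\<phi> t y) (\<phi> t x) \<le> \<epsilon>}"

definition reverse_flow :: "(real \<Rightarrow> 'a::metric_space \<Rightarrow> 'a) \<Rightarrow> real \<Rightarrow> 'a \<Rightarrow> 'a" where
  "reverse_flow \<phi> t = \<phi> (- t)"

definition local_unstable_set :: "(real \<Rightarrow> 'a::metric_space \<Rightarrow> 'a) \<Rightarrow> real \<Rightarrow> 'a \<Rightarrow> 'a set" where
  "local_unstable_set \<phi> = local_stable_set (reverse_flow \<phi>)"

definition local_product_structure_at ::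
    "(real \<Rightarrow> 'a::metric_space \<Rightarrow> 'a) \<Rightarrow> real \<Rightarrow> bool" where
  "local_product_structure_at \<phi> \<epsilon> \<longleftrightarrow>
     (\<exists>\<delta>>0. \<forall>x y. dist x y \<le> \<delta> \<longrightarrow>
        (\<exists>!\<tau>. \<bar>\<tau>\<bar> \<le> \<epsilon> \<and>
           (\<exists>z. local_stable_set \<phi> \<epsilon> (\<phi> \<tau> x) \<inter> local_unstable_set \<phi> \<epsilon> y = {z})))"

text \<open>
  The scale \<open>\<epsilon>\<close> is understood to be small. The condition at \<open>\<epsilon>\<close> is not monotone
  in \<open>\<epsilon>\<close>, and the uniqueness of \<open>\<tau>\<close> fails as soon as \<open>\<epsilon>\<close> reaches the period of some closed
  orbit (lemma \<open>not_local_product_structure_at_period\<close>). Read for literally every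
  \<open>\<epsilon> > 0\<close>, local product structure would exclude all closed orbits, and hence all flows having
  the orbit closing property on a compact space, where recurrent points always exist.
  Lemma \<open>local_product_structure_if_all\<close> shows that a flow satisfying the condition
  for every \<open>\<epsilon> > 0\<close> satisfies the definition.
\<close>

definition local_product_structure :: "(real \<Rightarrow> 'a::metric_space \<Rightarrow> 'a) \<Rightarrow> bool" where
  "local_product_structure \<phi> \<longleftrightarrow>
     (\<exists>\<epsilon>\<^sub>0>0. \<forall>\<epsilon>. 0 < \<epsilon> \<and> \<epsilon> \<le> \<epsilon>\<^sub>0 \<longrightarrow> local_product_structure_at \<phi> \<epsilon>)"

lemma local_product_structure_if_all:
  assumes "\<And>\<epsilon>. \<epsilon> > 0 \<Longrightarrow> local_product_structure_at \<phi> \<epsilon>"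
  shows "local_product_structure \<phi>"
  unfolding local_product_structure_def using assms by (intro exI[of _ 1]) auto

lemma not_local_product_structure_at_period:
  assumes flow: "continuous_flow \<phi>" and p: "0 < p" "p \<le> \<epsilon>" and per: "\<phi> p x = x"
  shows "\<not> local_product_structure_at \<phi> \<epsilon>"
proof
  assume "local_product_structure_at \<phi> \<epsilon>"
  then obtain \<delta> where "\<delta> > 0" and
    \<delta>: "\<And>x y. dist x y \<le> \<delta> \<Longrightarrow>
        (\<exists>!\<tau>. \<bar>\<tau>\<bar> \<le> \<epsilon> \<and>
           (\<exists>z. local_stable_set \<phi> \<epsilon> (\<phi> \<tau> x) \<inter> local_unstable_set \<phi> \<epsilon> y = {z}))"
    unfolding local_product_structure_at_def by blast
  let ?Q = "\<lambda>\<tau>. \<exists>z. local_stable_set \<phi> \<epsilon> (\<phi> \<tau> x) \<inter> local_unstable_set \<phi> \<epsilon> x = {z}"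
  have ex1: "\<exists>!\<tau>. \<bar>\<tau>\<bar> \<le> \<epsilon> \<and> ?Q \<tau>"
    using \<delta>[of x x] \<open>\<delta> > 0\<close> by simp
  then obtain \<tau> where \<tau>: "\<bar>\<tau>\<bar> \<le> \<epsilon>" "?Q \<tau>" by blast
  have add: "\<phi> (s + t) y = \<phi> s (\<phi> t y)" for s t y
    using flow by (simp add: continuous_flow_def)
  have plus: "\<phi> (\<tau> + p) x = \<phi> \<tau> x"
    by (simp add: add per)
  have minus: "\<phi> (\<tau> - p) x = \<phi> \<tau> x"
    using add[of "\<tau> - p" p x] by (simp add: per)
  show False
  proof (cases "\<tau> \<le> 0")
    case True
    then have "\<bar>\<tau> + p\<bar> \<le> \<epsilon> \<and> ?Q (\<tau> + p)" using \<tau> p plus by auto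
    then show False using ex1 \<tau> p by (metis add_cancel_left_right less_irrefl)
  next
    case False
    then have "\<bar>\<tau> - p\<bar> \<le> \<epsilon> \<and> ?Q (\<tau> - p)" using \<tau> p minus by auto
    then have "\<tau> - p = \<tau>" using ex1 \<tau> by blast
    then show False using p by simp
  qed
qed

definition pseudo_orbit ::
    "(real \<Rightarrow> 'a::metric_space \<Rightarrow> 'a) \<Rightarrow> real \<Rightarrow> real \<Rightarrow> (int \<Rightarrow> 'a) \<Rightarrow> (int \<Rightarrow> real) \<Rightarrow> bool" where
  "pseudo_orbit \<phi> \<delta> T x \<tau> \<longleftrightarrow>
     (\<forall>k. \<tau> k \<ge> T \<and> dist (\<phi> (\<tau> k) (x k)) (x (k + 1)) \<le> \<delta>)"

text \<open>
  For \<open>k \<ge> 0\<close> these are $s_k = \tau_0 + \dots + \tau_{k-1}$ and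
  $s_{-k} = \tau_{-k} + \dots + \tau_{-1}$; in particular the latter is nonnegative.
\<close>

definition forward_time :: "(int \<Rightarrow> real) \<Rightarrow> nat \<Rightarrow> real" where
  "forward_time \<tau> k = (\<Sum>j<k. \<tau> (int j))"

definition backward_time :: "(int \<Rightarrow> real) \<Rightarrow> nat \<Rightarrow> real" where
  "backward_time \<tau> k = (\<Sum>j=1..k. \<tau> (- int j))"

text \<open>The reparametrization in tracing is not required to be onto.\<close>

definition traced_by ::
    "(real \<Rightarrow> 'a::metric_space \<Rightarrow> 'a) \<Rightarrow> real \<Rightarrow> (int \<Rightarrow> 'a) \<Rightarrow> (int \<Rightarrow> real) \<Rightarrow> 'a \<Rightarrow> bool" where
  "traced_by \<phi> \<epsilon> x \<tau> y \<longleftrightarrow>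
     (\<exists>\<rho> :: real \<Rightarrow> real.
        strict_mono \<rho> \<and> continuous_on UNIV \<rho> \<and> continuous_on (range \<rho>) (inv \<rho>) \<and> \<rho> 0 = 0 \<and>
        (\<forall>k s. forward_time \<tau> k \<le> s \<and> s < forward_time \<tau> (k + 1) \<longrightarrow>
           dist (\<phi> (\<rho> s) y) (\<phi> (s - forward_time \<tau> k) (x (int k))) \<le> \<epsilon>) \<and>
        (\<forall>k\<ge>1. \<forall>s. - backward_time \<tau> k \<le> s \<and> s < - backward_time \<tau> (k - 1) \<longrightarrow>
           dist (\<phi> (\<rho> s) y) (\<phi> (s + backward_time \<tau> k) (x (- int k))) \<le> \<epsilon>))"

definition pseudo_orbit_tracing_property :: "(real \<Rightarrow> 'a::metric_space \<Rightarrow> 'a) \<Rightarrow> bool" where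
  "pseudo_orbit_tracing_property \<phi> \<longleftrightarrow>
     (\<forall>\<epsilon>>0. \<forall>T>0. \<exists>\<delta>>0. \<forall>x \<tau>. pseudo_orbit \<phi> \<delta> T x \<tau> \<longrightarrow> (\<exists>y. traced_by \<phi> \<epsilon> x \<tau> y))"

definition orbit_closing_property :: "(real \<Rightarrow> 'a::metric_space \<Rightarrow> 'a) \<Rightarrow> bool" where
  "orbit_closing_property \<phi> \<longleftrightarrow>
     (\<forall>\<epsilon>>0. \<exists>\<delta>>0. \<exists>T>0. \<forall>x t. t > T \<and> dist x (\<phi> t x) \<le> \<delta> \<longrightarrow>
        (\<exists>y l. l > 0 \<and> \<bar>l - t\<bar> \<le> \<epsilon> \<and> \<phi> l y = y \<and>
           (\<forall>s. 0 \<le> s \<and> s \<le> min t l \<longrightarrow> dist (\<phi> s x) (\<phi> s y) \<le> \<epsilon>)))"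

end

theory Submission
  imports Defs "HOL-Complex_Analysis.Great_Picard"
begin

text \<open>
  The proof follows the shadowing argument for hyperbolic sets, with compactness in place of
  exponential estimates. Two facts drive it.

  First, the flow contracts local stable sets uniformly, and the reversed flow contracts local
  unstable sets uniformly (\<open>uniform_contraction_stable_unstable\<close>). By compactness and expansivity, a
  failure of uniformity would produce pairs of points that converge to each other only after having
  differed by a time shift \<open>u \<noteq> 0\<close> along the orbit for arbitrarily long. Since intersections of small
  stable and unstable sets have at most one point (\<open>local_product_at_most_one\<close>), the uniqueness of the
  time displacement in the local product structure makes this displacement continuous
  (\<open>product_displacement_small\<close>), and such a shift is impossible.

  Second, a chain of orbit segments of equal length \<open>M\<close> with small jumps is traced by an orbit, with a
  bound on the jumps that does not depend on \<open>M\<close> once \<open>M\<close> is large (\<open>tracing\<close>). Each segment is joined to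
  the next by the product structure. Stable contraction makes the construction repeatable, and
  unstable contraction prevents the errors from accumulating when the final point is followed
  backwards (\<open>finite_chain_tracing\<close>); a compactness argument makes the chain bi-infinite
  (\<open>chain_tracing\<close>). The flow direction enters through the small time displacements, which are
  absorbed in a piecewise linear time change.

  A pseudo orbit becomes such a chain when it is sampled at the multiples of \<open>M\<close>. An almost closed orbit
  of length \<open>t\<close> is the periodic chain whose segments all have length \<open>M = t\<close>, so only one displacement
  occurs in each turn. Expansivity shows that the orbit tracing it is closed, and its period
  differs little from \<open>t\<close>.
\<close>

section \<open>Flows on compact spaces\<close>

locale compact_flow =
  fixes \<phi> :: "real \<Rightarrow> 'a::metric_space \<Rightarrow> 'a"
  assumes compact_space: "compact (UNIV :: 'a set)"
    and continuous_flow: "continuous_flow \<phi>"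
begin

lemma flow_0 [simp]: "\<phi> 0 x = x"
  using continuous_flow by (simp add: continuous_flow_def)

lemma flow_add: "\<phi> (s + t) x = \<phi> s (\<phi> t x)"
  using continuous_flow by (simp add: continuous_flow_def)

lemma flow_flow [simp]: "\<phi> s (\<phi> t x) = \<phi> (s + t) x"
  by (simp add: flow_add)

lemma tendsto_flow [tendsto_intros]:
  assumes "(f \<longlongrightarrow> x) F" "(g \<longlongrightarrow> t) F"
  shows "((\<lambda>n. \<phi> (g n) (f n)) \<longlongrightarrow> \<phi> t x) F"
proof -
  have c: "continuous_on UNIV (\<lambda>(x, t). \<phi> t x)"
    using continuous_flow by (simp add: continuous_flow_def)
  have "isCont (\<lambda>(x, t). \<phi> t x) (x, t)"
    using c by (simp add: continuous_on_eq_continuous_at)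
  then have "((\<lambda>n. case (f n, g n) of (x, t) \<Rightarrow> \<phi> t x) \<longlongrightarrow> (case (x, t) of (x, t) \<Rightarrow> \<phi> t x)) F"
    by (rule isCont_tendsto_compose) (intro tendsto_Pair assms)
  then show ?thesis by simp
qed

lemma convergent_subseq:
  fixes f :: "nat \<Rightarrow> 'a"
  obtains x r where "strict_mono r" "(\<lambda>n. f (r n)) \<longlonglongrightarrow> x"
  using seq_compactE[OF compact_space[unfolded compact_eq_seq_compact_metric], of f]
  unfolding o_def by blast

text \<open>
  Uniform continuity of the flow on the compact set \<open>UNIV \<times> [-L, L]\<close>, with one modulus for the point
  and the time.
\<close>

lemma uniformly_continuous_flow:
  assumes "\<epsilon> > 0"
  obtains \<delta> where "\<delta> > 0"
    "\<And>x y s t. \<bar>s\<bar> \<le> L \<Longrightarrow> \<bar>t\<bar> \<le> L \<Longrightarrow> dist x y \<le> \<delta> \<Longrightarrow> \<bar>s - t\<bar> \<le> \<delta> \<Longrightarrow>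
       dist (\<phi> s x) (\<phi> t y) \<le> \<epsilon>"
proof -
  have "compact ((UNIV :: 'a set) \<times> {-L..L})"
    by (intro compact_Times compact_space compact_Icc)
  moreover have "continuous_on ((UNIV :: 'a set) \<times> {-L..L}) (\<lambda>(x, t). \<phi> t x)"
    using continuous_flow continuous_on_subset unfolding continuous_flow_def by blast
  ultimately have "uniformly_continuous_on ((UNIV :: 'a set) \<times> {-L..L}) (\<lambda>(x, t). \<phi> t x)"
    by (intro compact_uniformly_continuous)
  then obtain d where d: "d > 0"
    "\<And>p q. p \<in> UNIV \<times> {-L..L} \<Longrightarrow> q \<in> UNIV \<times> {-L..L} \<Longrightarrow> dist q p < d \<Longrightarrow>
      dist (case q of (x, t) \<Rightarrow> \<phi> t x) (case p of (x, t) \<Rightarrow> \<phi> t x) < \<epsilon>"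
    using \<open>\<epsilon> > 0\<close> unfolding uniformly_continuous_on_def by metis
  show ?thesis
  proof (rule that[of "d / 3"])
    show "d / 3 > 0" using d by simp
    fix x y :: 'a and s t :: real
    assume *: "\<bar>s\<bar> \<le> L" "\<bar>t\<bar> \<le> L" "dist x y \<le> d / 3" "\<bar>s - t\<bar> \<le> d / 3"
    have "dist (x, s) (y, t) \<le> dist x y + dist s t"
      unfolding dist_prod_def by simp (rule sqrt_sum_squares_le_sum; simp)
    also have "\<dots> < d"
      using * d(1) by (simp add: dist_real_def)
    finally show "dist (\<phi> s x) (\<phi> t y) \<le> \<epsilon>"
      using d(2)[of "(y, t)" "(x, s)"] * by (auto simp: abs_le_iff)
  qed
qed

text \<open>
  Here the modulus is independent of the size of the times, because
  \<open>\<phi>\<^sup>s(x)\<close> and \<open>\<phi>\<^sup>t(x)\<close> differ by the flow over the short time \<open>s - t\<close>.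
\<close>

lemma flow_near_identity:
  assumes "\<epsilon> > 0"
  obtains \<eta> where "\<eta> > 0" "\<And>s t x. \<bar>s - t\<bar> \<le> \<eta> \<Longrightarrow> dist (\<phi> s x) (\<phi> t x) \<le> \<epsilon>"
proof -
  obtain \<delta> where \<delta>: "\<delta> > 0"
    "\<And>x y s t. \<bar>s\<bar> \<le> 1 \<Longrightarrow> \<bar>t\<bar> \<le> 1 \<Longrightarrow> dist x y \<le> \<delta> \<Longrightarrow> \<bar>s - t\<bar> \<le> \<delta> \<Longrightarrow>
       dist (\<phi> s x) (\<phi> t y) \<le> \<epsilon>"
    using uniformly_continuous_flow[OF assms, of 1] by blast
  show ?thesis
  proof (rule that[of "min \<delta> 1"])
    fix s t :: real and x :: 'a
    assume "\<bar>s - t\<bar> \<le> min \<delta> 1"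
    then show "dist (\<phi> s x) (\<phi> t x) \<le> \<epsilon>"
      using \<delta>(2)[of "s - t" 0 "\<phi> t x" "\<phi> t x"] \<delta>(1) by simp
  qed (use \<delta> in simp)
qed

text \<open>
  If points \<open>x\<^sub>n\<close> had periods \<open>v\<^sub>n \<noteq> 0\<close> tending to \<open>0\<close>, every time \<open>t\<close> would be an integer multiple of
  \<open>v\<^sub>n\<close> up to a remainder smaller than \<open>v\<^sub>n\<close>, so \<open>\<phi>\<^sup>t\<close> would move \<open>x\<^sub>n\<close> by less and less, and a limit of the
  \<open>x\<^sub>n\<close> would be a fixed point.
\<close>

lemma no_short_periods:
  assumes "fixed_point_free \<phi>"
  shows "\<exists>p>0. \<forall>v x. \<bar>v\<bar> \<le> p \<longrightarrow> \<phi> v x = x \<longrightarrow> v = 0"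
proof (rule ccontr)
  assume "\<not> ?thesis"
  then have "\<exists>v x. \<bar>v\<bar> \<le> p \<and> \<phi> v x = x \<and> v \<noteq> 0" if "p > 0" for p
    using that by blast
  then have "\<exists>v x. \<bar>v\<bar> \<le> 1 / (real n + 1) \<and> \<phi> v x = x \<and> v \<noteq> 0" for n
    by (simp add: add_pos_nonneg)
  then obtain v x where vx: "\<And>n. \<bar>v n\<bar> \<le> 1 / (real n + 1)" "\<And>n. \<phi> (v n) (x n) = x n" "\<And>n. v n \<noteq> 0"
    by metis
  obtain r y where r: "strict_mono r" "(\<lambda>n. x (r n)) \<longlonglongrightarrow> y"
    by (rule convergent_subseq)
  have v0: "(\<lambda>n. v (r n)) \<longlonglongrightarrow> 0"
  proof -
    have "(\<lambda>n. 1 / (real n + 1)) \<longlonglongrightarrow> 0"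
      using LIMSEQ_inverse_real_of_nat by (simp add: inverse_eq_divide add.commute)
    then have "v \<longlonglongrightarrow> 0"
      by (rule Lim_null_comparison[rotated]) (use vx(1) in simp)
    then show ?thesis using r(1) LIMSEQ_subseq_LIMSEQ by (fastforce simp: o_def)
  qed
  have mult_nat: "\<phi> (real m * v n) (x n) = x n" for m n
    by (induction m) (simp_all add: ring_distribs flow_add vx(2) del: flow_flow)
  have mult: "\<phi> (of_int m * v n) (x n) = x n" for m n
  proof (cases "m \<ge> 0")
    case True
    then show ?thesis using mult_nat[of "nat m" n] by simp
  next
    case False
    then have "\<phi> (of_int m * v n) (x n) = \<phi> (of_int m * v n) (\<phi> (real (nat (- m)) * v n) (x n))"
      by (simp only: mult_nat)
    also have "\<dots> = x n" using False by simp
    finally show ?thesis .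
  qed
  have "\<phi> t y = y" for t
  proof -
    define s where "s n = t - of_int \<lfloor>t / v n\<rfloor> * v n" for n
    have s_bound: "\<bar>s n\<bar> \<le> \<bar>v n\<bar>" for n
    proof -
      have "s n = frac (t / v n) * v n"
        using vx(3)[of n] by (simp add: s_def frac_def algebra_simps)
      then show ?thesis
        using frac_lt_1[of "t / v n"] frac_ge_0[of "t / v n"]
        by (simp add: abs_mult mult_left_le_one_le)
    qed
    have s: "\<phi> t (x n) = \<phi> (s n) (x n)" for n
      using arg_cong[OF mult[of "\<lfloor>t / v n\<rfloor>" n], of "\<phi> (s n)"] by (simp add: s_def)
    have "(\<lambda>n. s (r n)) \<longlonglongrightarrow> 0"
      by (rule Lim_null_comparison[OF _ tendsto_norm_zero[OF v0]]) (use s_bound in simp)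
    then have "(\<lambda>n. \<phi> (s (r n)) (x (r n))) \<longlonglongrightarrow> \<phi> 0 y"
      by (intro tendsto_intros r)
    moreover have "(\<lambda>n. \<phi> t (x (r n))) \<longlonglongrightarrow> \<phi> t y"
      by (intro tendsto_intros r)
    ultimately show ?thesis using LIMSEQ_unique unfolding s flow_0 by blast
  qed
  then show False using assms by (auto simp: fixed_point_free_def)
qed

section \<open>Local stable and unstable sets\<close>

lemma local_stable_setD:
  assumes "y \<in> local_stable_set \<phi> \<epsilon> x"
  shows "((\<lambda>t. dist (\<phi> t y) (\<phi> t x)) \<longlongrightarrow> 0) at_top"
    and "t \<ge> 0 \<Longrightarrow> dist (\<phi> t y) (\<phi> t x) \<le> \<epsilon>"
  using assms by (auto simp: local_stable_set_def stable_set_def)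

lemma local_stable_setI:
  assumes "((\<lambda>t. dist (\<phi> t y) (\<phi> t x)) \<longlongrightarrow> 0) at_top"
    and "\<And>t. t \<ge> 0 \<Longrightarrow> dist (\<phi> t y) (\<phi> t x) \<le> \<epsilon>"
  shows "y \<in> local_stable_set \<phi> \<epsilon> x"
  using assms by (auto simp: local_stable_set_def stable_set_def)

lemma local_stable_set_refl: "\<epsilon> \<ge> 0 \<Longrightarrow> x \<in> local_stable_set \<phi> \<epsilon> x"
  by (simp add: local_stable_setI)

lemma local_stable_set_sym:
  "y \<in> local_stable_set \<phi> \<epsilon> x \<Longrightarrow> x \<in> local_stable_set \<phi> \<epsilon> y"
  by (simp add: local_stable_set_def stable_set_def dist_commute)

lemma local_stable_set_mono:
  "y \<in> local_stable_set \<phi> \<epsilon> x \<Longrightarrow> \<epsilon> \<le> \<epsilon>' \<Longrightarrow> y \<in> local_stable_set \<phi> \<epsilon>' x"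
  by (auto simp: local_stable_set_def intro: order_trans)

lemma local_stable_set_trans:
  assumes y: "y \<in> local_stable_set \<phi> \<epsilon> x" and z: "z \<in> local_stable_set \<phi> \<epsilon>' y"
  shows "z \<in> local_stable_set \<phi> (\<epsilon> + \<epsilon>') x"
proof (rule local_stable_setI)
  have tri: "dist (\<phi> t z) (\<phi> t x) \<le> dist (\<phi> t y) (\<phi> t x) + dist (\<phi> t z) (\<phi> t y)" for t
    using dist_triangle[of "\<phi> t z" "\<phi> t x" "\<phi> t y"] by simp
  show "((\<lambda>t. dist (\<phi> t z) (\<phi> t x)) \<longlongrightarrow> 0) at_top"
  proof (rule Lim_null_comparison)
    show "\<forall>\<^sub>F t in at_top. norm (dist (\<phi> t z) (\<phi> t x)) \<le> dist (\<phi> t y) (\<phi> t x) + dist (\<phi> t z) (\<phi> t y)"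
      by (simp add: tri)
    show "((\<lambda>t. dist (\<phi> t y) (\<phi> t x) + dist (\<phi> t z) (\<phi> t y)) \<longlongrightarrow> 0) at_top"
      using tendsto_add[OF local_stable_setD(1)[OF y] local_stable_setD(1)[OF z]] by simp
  qed
  show "dist (\<phi> t z) (\<phi> t x) \<le> \<epsilon> + \<epsilon>'" if "t \<ge> 0" for t
    using tri[of t] local_stable_setD(2)[OF y that] local_stable_setD(2)[OF z that] by linarith
qed

text \<open>
  The asymptotic condition survives any time shift, so only the distance bound has to
  be supplied anew when a local stable set is moved by the flow.
\<close>

lemma local_stable_set_flow:
  assumes y: "y \<in> local_stable_set \<phi> \<epsilon> x"
    and bound: "\<And>t. t \<ge> s \<Longrightarrow> dist (\<phi> t y) (\<phi> t x) \<le> \<epsilon>'"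
  shows "\<phi> s y \<in> local_stable_set \<phi> \<epsilon>' (\<phi> s x)"
proof (rule local_stable_setI)
  have "filterlim (\<lambda>t. t + s) at_top at_top"
    using filterlim_tendsto_add_at_top[OF tendsto_const[of s] filterlim_ident]
    by (simp add: add.commute[of _ s])
  then show "((\<lambda>t. dist (\<phi> t (\<phi> s y)) (\<phi> t (\<phi> s x))) \<longlongrightarrow> 0) at_top"
    using filterlim_compose[OF local_stable_setD(1)[OF y], of "\<lambda>t. t + s"] by simp
  show "dist (\<phi> t (\<phi> s y)) (\<phi> t (\<phi> s x)) \<le> \<epsilon>'" if "t \<ge> 0" for t
    using bound[of "t + s"] that by simp
qed

text \<open>
  Statements on local unstable sets are obtained by interpreting the locale for the reversed flow.
  The interpretation is made inside the proofs: as a sublocale it would have to be iterated forever,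
  since reversing the flow twice gives back \<open>\<phi>\<close> only up to a provable equation.
\<close>

lemma compact_flow_reverse: "compact_flow (reverse_flow \<phi>)"
proof
  show "continuous_flow (reverse_flow \<phi>)"
    unfolding continuous_flow_def
  proof (intro conjI allI)
    have "continuous_on UNIV ((\<lambda>(x, t). \<phi> t x) \<circ> (\<lambda>(x, t). (x, - t)))"
    proof (rule continuous_on_compose)
      show "continuous_on UNIV (\<lambda>(x::'a, t::real). (x, - t))"
        by (auto intro!: continuous_intros simp: case_prod_unfold)
      show "continuous_on (range (\<lambda>(x::'a, t::real). (x, - t))) (\<lambda>(x, t). \<phi> t x)"
        using continuous_flow continuous_on_subset unfolding continuous_flow_def by blast
    qed
    then show "continuous_on UNIV (\<lambda>(x, t). reverse_flow \<phi> t x)"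
      by (simp add: o_def case_prod_unfold reverse_flow_def)
  qed (simp_all add: reverse_flow_def)
qed (rule compact_space)

lemma local_unstable_setD:
  assumes "y \<in> local_unstable_set \<phi> \<epsilon> x" "t \<le> 0"
  shows "dist (\<phi> t y) (\<phi> t x) \<le> \<epsilon>"
proof -
  interpret reverse: compact_flow "reverse_flow \<phi>" by (rule compact_flow_reverse)
  show ?thesis
    using reverse.local_stable_setD(2)[of y \<epsilon> x "- t"] assms
    by (simp add: local_unstable_set_def reverse_flow_def)
qed

section \<open>Uniform contraction on local stable and unstable sets\<close>

text \<open>
  The special case of the identical time change. It no longer distinguishes \<open>\<phi>\<close> from the
  reversed flow, which lets it serve stable and unstable sets alike.
\<close>

lemma expansive_identity_time:
  assumes "expansive \<phi>" "\<epsilon> > 0"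
  shows "\<exists>\<delta>>0. \<forall>x y. (\<forall>t. dist (\<phi> t y) (\<phi> t x) \<le> \<delta>) \<longrightarrow> (\<exists>u. \<bar>u\<bar> \<le> \<epsilon> \<and> y = \<phi> u x)"
proof -
  have "homeomorphism UNIV UNIV (\<lambda>t::real. t) (\<lambda>t. t)" "strict_mono (\<lambda>t::real. t)"
    by (auto simp: homeomorphism_def strict_mono_def)
  moreover obtain \<delta> where "\<delta> > 0" "\<And>x y \<rho> \<rho>' :: real \<Rightarrow> real. homeomorphism UNIV UNIV \<rho> \<rho>' \<Longrightarrow>
      strict_mono \<rho> \<Longrightarrow> \<rho> 0 = 0 \<Longrightarrow> (\<And>t. dist (\<phi> (\<rho> t) y) (\<phi> t x) \<le> \<delta>) \<Longrightarrow>
      \<exists>u. \<bar>u\<bar> \<le> \<epsilon> \<and> y = \<phi> u x"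
    using assms unfolding expansive_def by metis
  ultimately show ?thesis by (intro exI[of _ \<delta>]) blast
qed

text \<open>
  Two points of the intersection stay close for all times, so by expansivity they differ by a short
  time \<open>v\<close>. Since both are forward asymptotic to the orbit of \<open>x\<close>, a limit point \<open>q\<close> of their forward orbits
  has period \<open>v\<close>, which forces \<open>v = 0\<close>. Having at most one point, such an intersection is a singleton
  as soon as it is nonempty; this is what allows comparing the product structure at different scales.
\<close>

lemma local_product_at_most_one:
  assumes "fixed_point_free \<phi>" "expansive \<phi>"
  shows "\<exists>e>0. \<forall>x y z z'. z \<in> local_stable_set \<phi> e x \<inter> local_unstable_set \<phi> e y \<longrightarrow>
    z' \<in> local_stable_set \<phi> e x \<inter> local_unstable_set \<phi> e y \<longrightarrow> z = z'"
proof -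
  obtain p where p: "p > 0" "\<And>v x. \<bar>v\<bar> \<le> p \<Longrightarrow> \<phi> v x = x \<Longrightarrow> v = 0"
    using no_short_periods assms(1) by blast
  obtain d where d: "d > 0"
    "\<And>x y. (\<And>t. dist (\<phi> t y) (\<phi> t x) \<le> d) \<Longrightarrow> \<exists>u. \<bar>u\<bar> \<le> p \<and> y = \<phi> u x"
    using expansive_identity_time[OF assms(2) p(1)] by blast
  have "z = z'"
    if z: "z \<in> local_stable_set \<phi> (d / 2) x" "z \<in> local_unstable_set \<phi> (d / 2) y"
      and z': "z' \<in> local_stable_set \<phi> (d / 2) x" "z' \<in> local_unstable_set \<phi> (d / 2) y"
    for x y z z'
  proof -
    have "dist (\<phi> t z') (\<phi> t z) \<le> d" for t
    proof (cases "t \<ge> 0")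
      case True
      then have "dist (\<phi> t z') (\<phi> t x) \<le> d / 2" "dist (\<phi> t z) (\<phi> t x) \<le> d / 2"
        using local_stable_setD(2) z z' by blast+
      then show ?thesis
        using dist_triangle2[of "\<phi> t z'" "\<phi> t z" "\<phi> t x"] by linarith
    next
      case False
      then have "dist (\<phi> t z') (\<phi> t y) \<le> d / 2" "dist (\<phi> t z) (\<phi> t y) \<le> d / 2"
        by (intro local_unstable_setD z z'; simp)+
      then show ?thesis
        using dist_triangle2[of "\<phi> t z'" "\<phi> t z" "\<phi> t y"] by linarith
    qed
    then obtain v where v: "\<bar>v\<bar> \<le> p" "z' = \<phi> v z"
      using d(2) by blast
    have "z' \<in> local_stable_set \<phi> (d / 2 + d / 2) z"
      using local_stable_set_trans[OF local_stable_set_sym[OF z(1)] z'(1)] .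
    then have *: "((\<lambda>t. dist (\<phi> t z') (\<phi> t z)) \<longlongrightarrow> 0) at_top"
      by (rule local_stable_setD)
    obtain r q where r: "strict_mono r" "(\<lambda>n. \<phi> (real (r n)) z) \<longlonglongrightarrow> q"
      using convergent_subseq[of "\<lambda>n. \<phi> (real n) z"] by blast
    have "filterlim (\<lambda>n. real (r n)) at_top sequentially"
      using r(1) filterlim_compose filterlim_real_sequentially filterlim_subseq by blast
    from filterlim_compose[OF * this]
    have "(\<lambda>n. dist (\<phi> v (\<phi> (real (r n)) z)) (\<phi> (real (r n)) z)) \<longlonglongrightarrow> 0"
      by (simp add: v(2) add.commute)
    moreover have "(\<lambda>n. dist (\<phi> v (\<phi> (real (r n)) z)) (\<phi> (real (r n)) z)) \<longlonglongrightarrow> dist (\<phi> v q) q"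
      by (intro tendsto_intros r)
    ultimately have "\<phi> v q = q"
      using LIMSEQ_unique by fastforce
    then show "z = z'" using p(2) v by fastforce
  qed
  then show ?thesis using d(1) by (intro exI[of _ "d / 2"]) auto
qed

text \<open>
  The time displacement in the local product structure is continuous at the diagonal. If \<open>\<phi>\<^sup>u(x)\<close> is
  close to \<open>y\<close>, then \<open>- u\<close> is an admissible displacement for the pair \<open>(\<phi>\<^sup>u(x), y)\<close> at the scale \<open>e\<close>;
  the product structure at a smaller scale yields a displacement \<open>\<tau>\<close> that is small. Both are
  admissible at the scale \<open>e\<close>, and uniqueness there gives \<open>\<tau> = - u\<close>.
\<close>

lemma product_displacement_small:
  assumes "fixed_point_free \<phi>" "expansive \<phi>" "local_product_structure \<phi>"
  shows "\<exists>e>0. \<forall>\<epsilon>>0. \<exists>\<delta>>0. \<forall>x y z u.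
    z \<in> local_stable_set \<phi> e x \<inter> local_unstable_set \<phi> e y \<longrightarrow> \<bar>u\<bar> \<le> e \<longrightarrow>
    dist (\<phi> u x) y \<le> \<delta> \<longrightarrow> \<bar>u\<bar> \<le> \<epsilon>"
proof -
  obtain e1 where e1: "e1 > 0" "\<And>x y z z'. z \<in> local_stable_set \<phi> e1 x \<Longrightarrow> z \<in> local_unstable_set \<phi> e1 y \<Longrightarrow>
    z' \<in> local_stable_set \<phi> e1 x \<Longrightarrow> z' \<in> local_unstable_set \<phi> e1 y \<Longrightarrow> z = z'"
    using local_product_at_most_one[OF assms(1,2)] by blast
  obtain e2 where e2: "e2 > 0" "\<And>\<epsilon>. 0 < \<epsilon> \<Longrightarrow> \<epsilon> \<le> e2 \<Longrightarrow> local_product_structure_at \<phi> \<epsilon>"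
    using assms(3) unfolding local_product_structure_def by blast
  interpret reverse: compact_flow "reverse_flow \<phi>" by (rule compact_flow_reverse)
  define e where "e = min e1 e2"
  have e: "e > 0" "e \<le> e1" "e \<le> e2" using e1 e2 by (auto simp: e_def)
  have single: "local_stable_set \<phi> e x \<inter> local_unstable_set \<phi> e y = {z}"
    if "z \<in> local_stable_set \<phi> e x" "z \<in> local_unstable_set \<phi> e y" for x y z
    using that e1(2) local_stable_set_mono[OF _ e(2)] reverse.local_stable_set_mono[OF _ e(2)]
    unfolding local_unstable_set_def by blast
  have "\<exists>\<delta>>0. \<forall>x y z u.
    z \<in> local_stable_set \<phi> e x \<inter> local_unstable_set \<phi> e y \<longrightarrow> \<bar>u\<bar> \<le> e \<longrightarrow>
    dist (\<phi> u x) y \<le> \<delta> \<longrightarrow> \<bar>u\<bar> \<le> \<epsilon>" if "\<epsilon> > 0" for \<epsilon>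
  proof -
    define e' where "e' = min e \<epsilon>"
    have e': "0 < e'" "e' \<le> e" "e' \<le> \<epsilon>" using e that by (auto simp: e'_def)
    obtain d where d: "d > 0" "\<And>x y. dist x y \<le> d \<Longrightarrow> \<exists>!\<tau>. \<bar>\<tau>\<bar> \<le> e \<and>
        (\<exists>z. local_stable_set \<phi> e (\<phi> \<tau> x) \<inter> local_unstable_set \<phi> e y = {z})"
      using e2(2)[OF e(1,3)] unfolding local_product_structure_at_def by blast
    obtain d' where d': "d' > 0" "\<And>x y. dist x y \<le> d' \<Longrightarrow> \<exists>!\<tau>. \<bar>\<tau>\<bar> \<le> e' \<and>
        (\<exists>z. local_stable_set \<phi> e' (\<phi> \<tau> x) \<inter> local_unstable_set \<phi> e' y = {z})"
      using e2(2)[of e'] e e' unfolding local_product_structure_at_def by force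
    have "\<bar>u\<bar> \<le> \<epsilon>" if z: "z \<in> local_stable_set \<phi> e x" "z \<in> local_unstable_set \<phi> e y"
      and u: "\<bar>u\<bar> \<le> e" "dist (\<phi> u x) y \<le> min d d'" for x y z u
    proof -
      have large: "\<bar>- u\<bar> \<le> e \<and> (\<exists>z. local_stable_set \<phi> e (\<phi> (- u) (\<phi> u x)) \<inter> local_unstable_set \<phi> e y = {z})"
        using single[OF z] u(1) by simp
      obtain \<tau> z' where \<tau>: "\<bar>\<tau>\<bar> \<le> e'"
        "local_stable_set \<phi> e' (\<phi> \<tau> (\<phi> u x)) \<inter> local_unstable_set \<phi> e' y = {z'}"
        using d'(2)[of "\<phi> u x" y] u(2) by auto
      then have "z' \<in> local_stable_set \<phi> e' (\<phi> \<tau> (\<phi> u x))" "z' \<in> local_unstable_set \<phi> e' y"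
        by blast+
      then have "z' \<in> local_stable_set \<phi> e (\<phi> \<tau> (\<phi> u x))" "z' \<in> local_unstable_set \<phi> e y"
        using local_stable_set_mono[OF _ e'(2)] reverse.local_stable_set_mono[OF _ e'(2)]
        unfolding local_unstable_set_def by blast+
      then have "\<bar>\<tau>\<bar> \<le> e \<and> (\<exists>z. local_stable_set \<phi> e (\<phi> \<tau> (\<phi> u x)) \<inter> local_unstable_set \<phi> e y = {z})"
        using single \<tau>(1) e'(2) by fastforce
      then have "\<tau> = - u"
        using d(2)[of "\<phi> u x" y] u(2) large by auto
      then show ?thesis using \<tau>(1) e'(3) by simp
    qed
    then show ?thesis using d(1) d'(1) by (intro exI[of _ "min d d'"]) auto
  qed
  then show ?thesis using e(1) by blast
qed

text \<open>
  If contraction were not uniform, there would be pairs whose orbits are still \<open>\<epsilon>\<close> apart after times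
  tending to infinity. The orbits of a limit \<open>(p, q)\<close> of these late pairs are close for all times, so
  \<open>q = \<phi>\<^sup>u(p)\<close> for some small \<open>u\<close>. Expansivity alone cannot exclude \<open>u \<noteq> 0\<close>: a time shift that fades
  away arbitrarily slowly is conceivable. It is excluded by the hypothesis \<open>displacement\<close>, which says
  that a point of the local stable set cannot be close to a point shifted by a definite amount.
\<close>

lemma uniform_contraction:
  assumes orbit: "\<And>x y. (\<And>t. dist (\<phi> t y) (\<phi> t x) \<le> \<alpha>) \<Longrightarrow> \<exists>u. \<bar>u\<bar> \<le> e \<and> y = \<phi> u x"
    and displacement: "\<And>\<epsilon>. \<epsilon> > 0 \<Longrightarrow> \<exists>\<delta>>0. \<forall>x y u. y \<in> local_stable_set \<phi> \<alpha> x \<longrightarrow>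
      \<bar>u\<bar> \<le> e \<longrightarrow> dist (\<phi> u x) y \<le> \<delta> \<longrightarrow> \<bar>u\<bar> \<le> \<epsilon>"
    and "\<epsilon> > 0"
  shows "\<exists>T>0. \<forall>x y t. y \<in> local_stable_set \<phi> \<alpha> x \<longrightarrow> t \<ge> T \<longrightarrow> dist (\<phi> t y) (\<phi> t x) \<le> \<epsilon>"
proof (rule ccontr)
  assume "\<not> ?thesis"
  then have "\<exists>x y t. y \<in> local_stable_set \<phi> \<alpha> x \<and> t \<ge> T \<and> dist (\<phi> t y) (\<phi> t x) > \<epsilon>" if "T > 0" for T
    using that by (meson not_le)
  then have "\<exists>x y t. y \<in> local_stable_set \<phi> \<alpha> x \<and> t \<ge> real n + 1 \<and> dist (\<phi> t y) (\<phi> t x) > \<epsilon>" for n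
    by (simp add: add_nonneg_pos)
  then obtain x y t where xyt: "\<And>n. y n \<in> local_stable_set \<phi> \<alpha> (x n)" "\<And>n. t n \<ge> real n + 1"
    "\<And>n. dist (\<phi> (t n) (y n)) (\<phi> (t n) (x n)) > \<epsilon>"
    by metis
  define X Y where "X n = \<phi> (t n) (x n)" and "Y n = \<phi> (t n) (y n)" for n
  obtain r1 p where r1: "strict_mono r1" "(\<lambda>n. X (r1 n)) \<longlonglongrightarrow> p"
    by (rule convergent_subseq)
  obtain r2 q where r2: "strict_mono r2" "(\<lambda>n. Y (r1 (r2 n))) \<longlonglongrightarrow> q"
    using convergent_subseq[of "\<lambda>n. Y (r1 n)"] by blast
  define r where "r n = r1 (r2 n)" for n
  have r: "strict_mono r" using r1(1) r2(1) by (simp add: r_def strict_mono_def)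
  have Xp: "(\<lambda>n. X (r n)) \<longlonglongrightarrow> p"
    using LIMSEQ_subseq_LIMSEQ[OF r1(2) r2(1)] by (simp add: o_def r_def)
  have Yq: "(\<lambda>n. Y (r n)) \<longlonglongrightarrow> q" using r2(2) by (simp add: r_def)
  have tr: "t (r n) \<ge> real n" for n
    using xyt(2)[of "r n"] seq_suble[OF r, of n] by linarith
  have "dist (\<phi> s q) (\<phi> s p) \<le> \<alpha>" for s
  proof (rule LIMSEQ_le_const2)
    show "(\<lambda>n. dist (\<phi> s (Y (r n))) (\<phi> s (X (r n)))) \<longlonglongrightarrow> dist (\<phi> s q) (\<phi> s p)"
      by (intro tendsto_intros Xp Yq)
    have "dist (\<phi> s (Y (r n))) (\<phi> s (X (r n))) \<le> \<alpha>" if "n \<ge> nat \<lceil>- s\<rceil>" for n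
    proof -
      have "s + t (r n) \<ge> 0" using tr[of n] that by linarith
      then show ?thesis
        using local_stable_setD(2)[OF xyt(1)] by (simp add: X_def Y_def)
    qed
    then show "\<exists>N. \<forall>n\<ge>N. dist (\<phi> s (Y (r n))) (\<phi> s (X (r n))) \<le> \<alpha>" by blast
  qed
  then obtain u where u: "\<bar>u\<bar> \<le> e" "q = \<phi> u p" using orbit by blast
  have "\<bar>u\<bar> \<le> \<epsilon>'" if \<epsilon>': "\<epsilon>' > 0" for \<epsilon>'
  proof -
    obtain \<delta> where \<delta>: "\<delta> > 0" "\<And>x y u. y \<in> local_stable_set \<phi> \<alpha> x \<Longrightarrow>
      \<bar>u\<bar> \<le> e \<Longrightarrow> dist (\<phi> u x) y \<le> \<delta> \<Longrightarrow> \<bar>u\<bar> \<le> \<epsilon>'"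
      using displacement[OF \<epsilon>'] by blast
    have "(\<lambda>n. dist (\<phi> u (X (r n))) (Y (r n))) \<longlonglongrightarrow> dist (\<phi> u p) q"
      by (intro tendsto_intros Xp Yq)
    then have "\<forall>\<^sub>F n in sequentially. dist (\<phi> u (X (r n))) (Y (r n)) < \<delta>"
      using \<delta>(1) u(2) by (intro order_tendstoD) auto
    then obtain n where n: "dist (\<phi> u (X (r n))) (Y (r n)) < \<delta>"
      by (auto simp: eventually_sequentially)
    have "Y (r n) \<in> local_stable_set \<phi> \<alpha> (X (r n))"
      unfolding X_def Y_def
    proof (rule local_stable_set_flow[OF xyt(1)])
      fix s assume "t (r n) \<le> s"
      then show "dist (\<phi> s (y (r n))) (\<phi> s (x (r n))) \<le> \<alpha>"
        using local_stable_setD(2)[OF xyt(1)] tr[of n] by simp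
    qed
    then show ?thesis using \<delta>(2) u(1) n by fastforce
  qed
  then have "u = 0" by (metis abs_ge_zero abs_eq_0 dense_ge order_antisym)
  moreover have "dist q p \<ge> \<epsilon>"
  proof (rule LIMSEQ_le_const)
    show "(\<lambda>n. dist (Y (r n)) (X (r n))) \<longlonglongrightarrow> dist q p"
      by (intro tendsto_intros Xp Yq)
    show "\<exists>N. \<forall>n\<ge>N. \<epsilon> \<le> dist (Y (r n)) (X (r n))"
      using xyt(3) by (auto simp: X_def Y_def less_imp_le)
  qed
  ultimately show False using u(2) \<open>\<epsilon> > 0\<close> by simp
qed

text \<open>
  Both contraction statements come from the previous lemma. In the bound on the displacement, the
  intersection point is \<open>y\<close> itself in the stable case, and the centre \<open>x\<close> in the unstable case.
\<close>

lemma uniform_contraction_stable_unstable: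
  assumes "fixed_point_free \<phi>" "expansive \<phi>" "local_product_structure \<phi>"
  shows "\<exists>\<alpha>>0. \<forall>\<epsilon>>0. \<exists>T>0. \<forall>x y t. t \<ge> T \<longrightarrow>
    (y \<in> local_stable_set \<phi> \<alpha> x \<longrightarrow> dist (\<phi> t y) (\<phi> t x) \<le> \<epsilon>) \<and>
    (y \<in> local_unstable_set \<phi> \<alpha> x \<longrightarrow> dist (\<phi> (- t) y) (\<phi> (- t) x) \<le> \<epsilon>)"
proof -
  interpret reverse: compact_flow "reverse_flow \<phi>" by (rule compact_flow_reverse)
  obtain e where e: "e > 0" "\<And>\<epsilon>. \<epsilon> > 0 \<Longrightarrow> \<exists>\<delta>>0. \<forall>x y z u.
    z \<in> local_stable_set \<phi> e x \<inter> local_unstable_set \<phi> e y \<longrightarrow> \<bar>u\<bar> \<le> e \<longrightarrow>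
    dist (\<phi> u x) y \<le> \<delta> \<longrightarrow> \<bar>u\<bar> \<le> \<epsilon>"
    using product_displacement_small[OF assms] by blast
  obtain d where d: "d > 0"
    "\<And>x y. (\<And>t. dist (\<phi> t y) (\<phi> t x) \<le> d) \<Longrightarrow> \<exists>u. \<bar>u\<bar> \<le> e \<and> y = \<phi> u x"
    using expansive_identity_time[OF assms(2) e(1)] by blast
  define \<alpha> where "\<alpha> = min d e"
  have \<alpha>: "\<alpha> > 0" "\<alpha> \<le> d" "\<alpha> \<le> e" using d e by (auto simp: \<alpha>_def)
  have stable: "\<exists>T>0. \<forall>x y t. y \<in> local_stable_set \<phi> \<alpha> x \<longrightarrow> t \<ge> T \<longrightarrow> dist (\<phi> t y) (\<phi> t x) \<le> \<epsilon>"
    if "\<epsilon> > 0" for \<epsilon>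
  proof (rule uniform_contraction[OF _ _ that])
    show "\<exists>u. \<bar>u\<bar> \<le> e \<and> y = \<phi> u x" if "\<And>t. dist (\<phi> t y) (\<phi> t x) \<le> \<alpha>" for x y
      using d(2) \<alpha>(2) that order_trans by blast
    fix \<epsilon> :: real assume "\<epsilon> > 0"
    obtain \<delta> where \<delta>: "\<delta> > 0" "\<And>x y z u.
      z \<in> local_stable_set \<phi> e x \<Longrightarrow> z \<in> local_unstable_set \<phi> e y \<Longrightarrow> \<bar>u\<bar> \<le> e \<Longrightarrow>
      dist (\<phi> u x) y \<le> \<delta> \<Longrightarrow> \<bar>u\<bar> \<le> \<epsilon>"
      using e(2)[OF \<open>\<epsilon> > 0\<close>] by blast
    moreover have "y \<in> local_unstable_set \<phi> e y" for y
      unfolding local_unstable_set_def by (rule reverse.local_stable_set_refl) (use e in simp)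
    ultimately show "\<exists>\<delta>>0. \<forall>x y u. y \<in> local_stable_set \<phi> \<alpha> x \<longrightarrow>
      \<bar>u\<bar> \<le> e \<longrightarrow> dist (\<phi> u x) y \<le> \<delta> \<longrightarrow> \<bar>u\<bar> \<le> \<epsilon>"
      using local_stable_set_mono[OF _ \<alpha>(3)] by blast
  qed
  have unstable: "\<exists>T>0. \<forall>x y t. y \<in> local_stable_set (reverse_flow \<phi>) \<alpha> x \<longrightarrow> t \<ge> T \<longrightarrow>
      dist (reverse_flow \<phi> t y) (reverse_flow \<phi> t x) \<le> \<epsilon>"
    if "\<epsilon> > 0" for \<epsilon>
  proof (rule reverse.uniform_contraction[OF _ _ that])
    show "\<exists>u. \<bar>u\<bar> \<le> e \<and> y = reverse_flow \<phi> u x"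
      if *: "\<And>t. dist (reverse_flow \<phi> t y) (reverse_flow \<phi> t x) \<le> \<alpha>" for x y
    proof -
      have "dist (\<phi> t y) (\<phi> t x) \<le> d" for t
        using *[of "- t"] \<alpha>(2) by (simp add: reverse_flow_def)
      then obtain u where "\<bar>u\<bar> \<le> e" "y = \<phi> u x" using d(2) by blast
      then show ?thesis by (intro exI[of _ "- u"]) (simp add: reverse_flow_def)
    qed
    fix \<epsilon> :: real assume "\<epsilon> > 0"
    obtain \<delta> where \<delta>: "\<delta> > 0" "\<And>x y z u.
      z \<in> local_stable_set \<phi> e x \<Longrightarrow> z \<in> local_unstable_set \<phi> e y \<Longrightarrow> \<bar>u\<bar> \<le> e \<Longrightarrow>
      dist (\<phi> u x) y \<le> \<delta> \<Longrightarrow> \<bar>u\<bar> \<le> \<epsilon>"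
      using e(2)[OF \<open>\<epsilon> > 0\<close>] by blast
    have "\<bar>u\<bar> \<le> \<epsilon>" if y: "y \<in> local_stable_set (reverse_flow \<phi>) \<alpha> x"
      and u: "\<bar>u\<bar> \<le> e" "dist (reverse_flow \<phi> u x) y \<le> \<delta>" for x y u
    proof -
      have "x \<in> local_unstable_set \<phi> e y"
        unfolding local_unstable_set_def
        using reverse.local_stable_set_mono[OF reverse.local_stable_set_sym[OF y] \<alpha>(3)] .
      moreover have "x \<in> local_stable_set \<phi> e x"
        by (rule local_stable_set_refl) (use e in simp)
      ultimately show ?thesis
        using \<delta>(2)[of x x y "- u"] u by (simp add: reverse_flow_def)
    qed
    then show "\<exists>\<delta>>0. \<forall>x y u. y \<in> local_stable_set (reverse_flow \<phi>) \<alpha> x \<longrightarrow>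
      \<bar>u\<bar> \<le> e \<longrightarrow> dist (reverse_flow \<phi> u x) y \<le> \<delta> \<longrightarrow> \<bar>u\<bar> \<le> \<epsilon>"
      using \<delta>(1) by blast
  qed
  show ?thesis
  proof (intro exI[of _ \<alpha>] conjI \<alpha>(1), intro allI impI)
    fix \<epsilon> :: real assume "\<epsilon> > 0"
    obtain T1 where T1: "T1 > 0" "\<And>x y t. y \<in> local_stable_set \<phi> \<alpha> x \<Longrightarrow> t \<ge> T1 \<Longrightarrow>
      dist (\<phi> t y) (\<phi> t x) \<le> \<epsilon>"
      using stable[OF \<open>\<epsilon> > 0\<close>] by blast
    obtain T2 where T2: "T2 > 0" "\<And>x y t. y \<in> local_unstable_set \<phi> \<alpha> x \<Longrightarrow> t \<ge> T2 \<Longrightarrow>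
      dist (\<phi> (- t) y) (\<phi> (- t) x) \<le> \<epsilon>"
      using unstable[OF \<open>\<epsilon> > 0\<close>] unfolding local_unstable_set_def reverse_flow_def by blast
    show "\<exists>T>0. \<forall>x y t. t \<ge> T \<longrightarrow>
      (y \<in> local_stable_set \<phi> \<alpha> x \<longrightarrow> dist (\<phi> t y) (\<phi> t x) \<le> \<epsilon>) \<and>
      (y \<in> local_unstable_set \<phi> \<alpha> x \<longrightarrow> dist (\<phi> (- t) y) (\<phi> (- t) x) \<le> \<epsilon>)"
      using T1 T2 by (intro exI[of _ "max T1 T2"]) auto
  qed
qed

end

section \<open>Tracing chains of orbit segments of equal length\<close>

text \<open>
  The quantities that the tracing argument balances: \<open>\<eta>\<close> is the scale of the local sets and
  \<open>\<delta>\<close> is a distance at which the product structure yields that scale. An orbit segment of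
  length \<open>M\<close>, shortened by a displacement of at most \<open>\<eta>\<close>, is long enough for stable sets to be contracted to
  half of \<open>\<delta>\<close>, and for unstable sets of size \<open>2\<eta>\<close> to be contracted, in backward time, to size \<open>\<eta>\<close>. The distance that
  points move in a time of at most \<open>2\<eta>\<close> is bounded by \<open>\<omega>\<close>.
\<close>

locale tracing_scales = compact_flow +
  fixes \<eta> \<omega> \<delta> T M :: real
  assumes pos: "\<eta> > 0" "\<delta> > 0" "T \<ge> 0" and long: "T + \<eta> \<le> M"
    and product: "\<And>x y. dist x y \<le> \<delta> \<Longrightarrow>
      \<exists>\<tau> z. \<bar>\<tau>\<bar> \<le> \<eta> \<and> z \<in> local_stable_set \<phi> \<eta> (\<phi> \<tau> x) \<and> z \<in> local_unstable_set \<phi> \<eta> y"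
    and stable_contraction: "\<And>x y t. y \<in> local_stable_set \<phi> \<eta> x \<Longrightarrow> t \<ge> T \<Longrightarrow>
      dist (\<phi> t y) (\<phi> t x) \<le> \<delta> / 2"
    and unstable_contraction: "\<And>x y t. y \<in> local_unstable_set \<phi> (2 * \<eta>) x \<Longrightarrow> t \<ge> T \<Longrightarrow>
      dist (\<phi> (- t) y) (\<phi> (- t) x) \<le> \<eta>"
    and short_time: "\<And>s t x. \<bar>s - t\<bar> \<le> 2 * \<eta> \<Longrightarrow> dist (\<phi> s x) (\<phi> t x) \<le> \<omega>"
begin

text \<open>
  Choose successively points \<open>x'\<^sub>n\<close> in the local stable set of \<open>\<phi>\<^bsup>\<tau>\<^esup>(\<xi>\<^sub>n)\<close>, with \<open>\<tau> = \<tau>\<^sub>n\<close> small, such that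
  \<open>x'\<^bsub>n+1\<^esub>\<close> lies in the local unstable set of \<open>\<phi>\<^bsup>M - \<tau>\<^esup>(x'\<^sub>n)\<close>; stable contraction keeps that point near
  \<open>\<phi>\<^sup>M(\<xi>\<^sub>n)\<close>, hence near \<open>\<xi>\<^bsub>n+1\<^esub>\<close>, so the choice can go on. The tracing orbit is that of the last point
  \<open>x'\<^sub>N\<close>. Going backwards, its position at stage \<open>n\<close> stays in the unstable set of \<open>x'\<^sub>n\<close> of size \<open>\<eta>\<close>: in one
  step the size grows to \<open>2\<eta>\<close> by passing from \<open>x'\<^bsub>n+1\<^esub>\<close> to \<open>\<phi>\<^bsup>M - \<tau>\<^esup>(x'\<^sub>n)\<close>, and the backward flow brings it
  back to \<open>\<eta>\<close>. The errors therefore do not accumulate, although no rate of contraction is known.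
\<close>

lemma finite_chain_tracing:
  fixes \<xi> :: "nat \<Rightarrow> 'a"
  assumes jump: "\<And>n. dist (\<phi> M (\<xi> n)) (\<xi> (Suc n)) \<le> \<delta> / 2"
  shows "\<exists>z a. a 0 = 0 \<and> (\<forall>n. \<bar>a (Suc n) - a n - M\<bar> \<le> \<eta>) \<and>
    (\<forall>n t. n < N \<and> 0 \<le> t \<and> t \<le> M \<longrightarrow>
      dist (\<phi> (a n + t) z) (\<phi> t (\<xi> n)) \<le> 3 * \<eta> + 2 * \<omega>)"
proof -
  interpret reverse: compact_flow "reverse_flow \<phi>" by (rule compact_flow_reverse)
  define P where "P n p \<longleftrightarrow> \<bar>snd p\<bar> \<le> \<eta> \<and> fst p \<in> local_stable_set \<phi> \<eta> (\<phi> (snd p) (\<xi> n))"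
    for n and p :: "'a \<times> real"
  define Q where "Q p q \<longleftrightarrow> fst q \<in> local_unstable_set \<phi> \<eta> (\<phi> (M - snd p) (fst p))"
    for p q :: "'a \<times> real"
  have "\<exists>f. \<forall>n. P n (f n) \<and> Q (f n) (f (Suc n))"
  proof (rule dependent_nat_choice)
    have "P 0 (\<xi> 0, 0)" using pos by (simp add: P_def local_stable_set_refl)
    then show "\<exists>p. P 0 p" ..
    fix p n assume p: "P n p"
    then have \<tau>: "\<bar>snd p\<bar> \<le> \<eta>" and x: "fst p \<in> local_stable_set \<phi> \<eta> (\<phi> (snd p) (\<xi> n))"
      by (auto simp: P_def)
    have "dist (\<phi> (M - snd p) (fst p)) (\<phi> (M - snd p) (\<phi> (snd p) (\<xi> n))) \<le> \<delta> / 2"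
      using \<tau> long by (intro stable_contraction[OF x]) linarith
    then have "dist (\<xi> (Suc n)) (\<phi> (M - snd p) (fst p)) \<le> \<delta>"
      using jump[of n] dist_triangle3[of "\<xi> (Suc n)" "\<phi> (M - snd p) (fst p)" "\<phi> M (\<xi> n)"]
      by (simp add: dist_commute)
    from product[OF this] obtain \<sigma> z where "\<bar>\<sigma>\<bar> \<le> \<eta>"
      "z \<in> local_stable_set \<phi> \<eta> (\<phi> \<sigma> (\<xi> (Suc n)))"
      "z \<in> local_unstable_set \<phi> \<eta> (\<phi> (M - snd p) (fst p))" by blast
    then have "P (Suc n) (z, \<sigma>) \<and> Q p (z, \<sigma>)" by (simp add: P_def Q_def)
    then show "\<exists>q. P (Suc n) q \<and> Q p q" ..
  qed
  then obtain f where f: "\<And>n. P n (f n)" "\<And>n. Q (f n) (f (Suc n))" by blast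
  define x' \<tau> where "x' n = fst (f n)" and "\<tau> n = snd (f n)" for n
  have \<tau>: "\<bar>\<tau> n\<bar> \<le> \<eta>" and stable: "x' n \<in> local_stable_set \<phi> \<eta> (\<phi> (\<tau> n) (\<xi> n))"
    and unstable: "x' (Suc n) \<in> local_unstable_set \<phi> \<eta> (\<phi> (M - \<tau> n) (x' n))" for n
    using f[of n] by (auto simp: P_def Q_def x'_def \<tau>_def)
  define a where "a n = (\<Sum>j<n. M - \<tau> j)" for n
  have a_Suc: "a (Suc n) = a n + (M - \<tau> n)" for n by (simp add: a_def)
  define z where "z = \<phi> (- a N) (x' N)"
  have unstable_step: "\<phi> (a (Suc n)) z \<in> local_unstable_set \<phi> (2 * \<eta>) (\<phi> (M - \<tau> n) (x' n))"
    if "\<phi> (a (Suc n)) z \<in> local_unstable_set \<phi> \<eta> (x' (Suc n))" for n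
    using reverse.local_stable_set_trans[OF unstable[of n, unfolded local_unstable_set_def]
      that[unfolded local_unstable_set_def]]
    by (simp add: local_unstable_set_def)
  have z: "\<phi> (a n) z \<in> local_unstable_set \<phi> \<eta> (x' n)" if "n \<le> N" for n
    using that
  proof (induction n rule: inc_induct)
    case base
    show ?case using pos unfolding local_unstable_set_def z_def
      by (simp add: reverse.local_stable_set_refl)
  next
    case (step n)
    let ?c = "M - \<tau> n"
    have w: "\<phi> (a (Suc n)) z \<in> local_stable_set (reverse_flow \<phi>) (2 * \<eta>) (\<phi> ?c (x' n))"
      using unstable_step[OF step.IH]
      by (simp add: local_unstable_set_def)
    have "reverse_flow \<phi> ?c (\<phi> (a (Suc n)) z) \<in> local_stable_set (reverse_flow \<phi>) \<eta>
        (reverse_flow \<phi> ?c (\<phi> ?c (x' n)))"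
    proof (rule reverse.local_stable_set_flow[OF w])
      fix t assume "?c \<le> t"
      then have "t \<ge> T" using \<tau>[of n] long by linarith
      then show "dist (reverse_flow \<phi> t (\<phi> (a (Suc n)) z)) (reverse_flow \<phi> t (\<phi> ?c (x' n))) \<le> \<eta>"
        using unstable_contraction w unfolding local_unstable_set_def reverse_flow_def by blast
    qed
    then show ?case by (simp add: local_unstable_set_def reverse_flow_def a_Suc)
  qed
  have "dist (\<phi> (a n + t) z) (\<phi> t (\<xi> n)) \<le> 3 * \<eta> + 2 * \<omega>" if "n < N" "0 \<le> t" "t \<le> M" for n t
  proof -
    \<comment> \<open>For negative displacement the segment of \<open>z\<close> lasts at least until \<open>M\<close>; for positive
      displacement it is cut at \<open>M - \<tau>\<^sub>n\<close>, which costs a time of at most \<open>\<eta>\<close>.\<close>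
    let ?c = "M - \<tau> n"
    define s where "s = min t ?c"
    have s: "0 \<le> s" "s \<le> ?c" "\<bar>t - s\<bar> \<le> \<eta>"
      using that \<tau>[of n] long pos by (auto simp: s_def)
    have 1: "dist (\<phi> (a n + t) z) (\<phi> (a n + s) z) \<le> \<omega>"
      using s pos by (intro short_time) simp
    have "dist (\<phi> (s - ?c) (\<phi> (a (Suc n)) z)) (\<phi> (s - ?c) (\<phi> ?c (x' n))) \<le> 2 * \<eta>"
      using s that(1) by (intro local_unstable_setD[OF unstable_step] z) auto
    then have 2: "dist (\<phi> (a n + s) z) (\<phi> s (x' n)) \<le> 2 * \<eta>"
      by (simp add: a_Suc algebra_simps)
    have 3: "dist (\<phi> s (x' n)) (\<phi> (s + \<tau> n) (\<xi> n)) \<le> \<eta>"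
      using local_stable_setD(2)[OF stable s(1), of n] by simp
    have 4: "dist (\<phi> (s + \<tau> n) (\<xi> n)) (\<phi> t (\<xi> n)) \<le> \<omega>"
      using s(3) \<tau>[of n] by (intro short_time) linarith
    show ?thesis
      using 1 2 3 4 dist_triangle[of "\<phi> (a n + t) z" "\<phi> t (\<xi> n)" "\<phi> (a n + s) z"]
        dist_triangle[of "\<phi> (a n + s) z" "\<phi> t (\<xi> n)" "\<phi> s (x' n)"]
        dist_triangle[of "\<phi> s (x' n)" "\<phi> t (\<xi> n)" "\<phi> (s + \<tau> n) (\<xi> n)"]
      by linarith
  qed
  moreover have "a 0 = 0" by (simp add: a_def)
  moreover have "\<bar>a (Suc n) - a n - M\<bar> \<le> \<eta>" for n
    using \<tau>[of n] by (simp add: a_Suc)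
  ultimately show ?thesis by (intro exI[of _ z] exI[of _ a]) auto
qed

text \<open>
  The window \<open>[-R, R)\<close> is traced by shifting indices. Outside the range of the traced stages the times
  are continued with slope \<open>M\<close>, so that the bound on the increments holds for all integers, as the
  passage to the limit \<open>R \<rightarrow> \<infinity>\<close> needs.
\<close>

lemma two_sided_finite_chain_tracing:
  fixes x :: "int \<Rightarrow> 'a" and R :: nat
  assumes jump: "\<And>k. dist (\<phi> M (x k)) (x (k + 1)) \<le> \<delta> / 2"
  shows "\<exists>y a. a 0 = 0 \<and> (\<forall>k::int. \<bar>a (k + 1) - a k - M\<bar> \<le> \<eta>) \<and>
    (\<forall>k t. - int R \<le> k \<and> k < int R \<and> 0 \<le> t \<and> t \<le> M \<longrightarrow>
      dist (\<phi> (a k + t) y) (\<phi> t (x k)) \<le> 3 * \<eta> + 2 * \<omega>)"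
proof -
  have "dist (\<phi> M (x (int n - int R))) (x (int (Suc n) - int R)) \<le> \<delta> / 2" for n
    using jump[of "int n - int R"] by (simp add: algebra_simps)
  from finite_chain_tracing[of "\<lambda>n. x (int n - int R)" "2 * R", OF this]
  obtain z A where A: "A 0 = 0" "\<And>n. \<bar>A (Suc n) - A n - M\<bar> \<le> \<eta>"
    and z: "\<And>n t. n < 2 * R \<Longrightarrow> 0 \<le> t \<Longrightarrow> t \<le> M \<Longrightarrow>
      dist (\<phi> (A n + t) z) (\<phi> t (x (int n - int R))) \<le> 3 * \<eta> + 2 * \<omega>"
    by blast
  define B :: "int \<Rightarrow> real" where "B m = (if m \<ge> 0 then A (nat m) else of_int m * M)" for m
  have B: "\<bar>B (m + 1) - B m - M\<bar> \<le> \<eta>" for m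
  proof (cases "m \<ge> 0")
    case True
    then show ?thesis using A(2)[of "nat m"] by (simp add: B_def nat_add_distrib)
  next
    case False
    then show ?thesis
      using pos A(1) by (cases "m = -1") (auto simp: B_def algebra_simps)
  qed
  define a where "a k = B (k + int R) - B (int R)" for k
  define y where "y = \<phi> (A R) z"
  have "dist (\<phi> (a k + t) y) (\<phi> t (x k)) \<le> 3 * \<eta> + 2 * \<omega>"
    if "- int R \<le> k" "k < int R" "0 \<le> t" "t \<le> M" for k t
    using z[of "nat (k + int R)" t] that by (simp add: a_def B_def y_def algebra_simps)
  moreover have "\<bar>a (k + 1) - a k - M\<bar> \<le> \<eta>" for k
    using B[of "k + int R"] by (simp add: a_def algebra_simps)
  moreover have "a 0 = 0" by (simp add: a_def)
  ultimately show ?thesis by (intro exI[of _ y] exI[of _ a]) auto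
qed

text \<open>
  A limit of the tracing orbits of the windows \<open>[-R, R)\<close>. The times at which stages begin are unbounded in \<open>k\<close>,
  but their increments deviate from \<open>M\<close> by at most \<open>\<eta>\<close>, so a diagonal subsequence makes all
  increments converge, and with them the times.
\<close>

lemma chain_tracing:
  fixes x :: "int \<Rightarrow> 'a"
  assumes jump: "\<And>k. dist (\<phi> M (x k)) (x (k + 1)) \<le> \<delta> / 2"
  shows "\<exists>y a. a 0 = 0 \<and> (\<forall>k::int. \<bar>a (k + 1) - a k - M\<bar> \<le> \<eta>) \<and>
    (\<forall>k t. 0 \<le> t \<and> t \<le> M \<longrightarrow> dist (\<phi> (a k + t) y) (\<phi> t (x k)) \<le> 3 * \<eta> + 2 * \<omega>)"
proof -
  have "\<forall>R. \<exists>y a. a 0 = 0 \<and> (\<forall>k::int. \<bar>a (k + 1) - a k - M\<bar> \<le> \<eta>) \<and>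
    (\<forall>k t. - int R \<le> k \<and> k < int R \<and> 0 \<le> t \<and> t \<le> M \<longrightarrow>
      dist (\<phi> (a k + t) y) (\<phi> t (x k)) \<le> 3 * \<eta> + 2 * \<omega>)"
    by (intro allI two_sided_finite_chain_tracing jump)
  then obtain Y A where A0: "\<And>R. A R 0 = 0"
    and A: "\<And>R k. \<bar>A R (k + 1) - A R k - M\<bar> \<le> \<eta>"
    and Y: "\<And>R k t. - int R \<le> k \<Longrightarrow> k < int R \<Longrightarrow> 0 \<le> t \<Longrightarrow> t \<le> M \<Longrightarrow>
      dist (\<phi> (A R k + t) (Y R)) (\<phi> t (x k)) \<le> 3 * \<eta> + 2 * \<omega>"
    unfolding choice_iff by blast
  define g where "g R k = A R (k + 1) - A R k - M" for R k
  obtain r1 where r1: "strict_mono r1" "\<And>k. \<exists>l. (\<lambda>n. g (r1 n) k) \<longlonglongrightarrow> l"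
    using function_convergent_subsequence[of "UNIV :: int set" g \<eta>] A by (auto simp: g_def)
  obtain r2 y where r2: "strict_mono r2" "(\<lambda>n. Y (r1 (r2 n))) \<longlonglongrightarrow> y"
    using convergent_subseq[of "\<lambda>n. Y (r1 n)"] by blast
  define r where "r n = r1 (r2 n)" for n
  have r: "strict_mono r" using r1(1) r2(1) by (simp add: r_def strict_mono_def)
  have Yr: "(\<lambda>n. Y (r n)) \<longlonglongrightarrow> y" using r2(2) by (simp add: r_def)
  have "\<exists>l. (\<lambda>n. g (r n) k) \<longlonglongrightarrow> l" for k
    using r1(2)[of k] LIMSEQ_subseq_LIMSEQ[OF _ r2(1)] unfolding o_def r_def by blast
  then obtain d where d: "\<And>k. (\<lambda>n. g (r n) k) \<longlonglongrightarrow> d k" by metis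
  have "\<exists>l. (\<lambda>n. A (r n) k) \<longlonglongrightarrow> l" for k
  proof (induction k rule: int_induct[where k = 0])
    case base
    then show ?case using A0 by auto
  next
    case (step1 i)
    then obtain l where "(\<lambda>n. A (r n) i) \<longlonglongrightarrow> l" by blast
    then have "(\<lambda>n. A (r n) i + (g (r n) i + M)) \<longlonglongrightarrow> l + (d i + M)"
      by (intro tendsto_intros d)
    then show ?case by (auto simp: g_def)
  next
    case (step2 i)
    then obtain l where "(\<lambda>n. A (r n) i) \<longlonglongrightarrow> l" by blast
    then have "(\<lambda>n. A (r n) i - (g (r n) (i - 1) + M)) \<longlonglongrightarrow> l - (d (i - 1) + M)"
      by (intro tendsto_intros d)
    then show ?case by (auto simp: g_def)
  qed
  then obtain a where a: "\<And>k. (\<lambda>n. A (r n) k) \<longlonglongrightarrow> a k" by metis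
  have "a 0 = 0"
    using a[of 0] A0 by (simp add: LIMSEQ_const_iff)
  moreover have "\<bar>a (k + 1) - a k - M\<bar> \<le> \<eta>" for k
  proof (rule LIMSEQ_le_const2)
    show "(\<lambda>n. \<bar>A (r n) (k + 1) - A (r n) k - M\<bar>) \<longlonglongrightarrow> \<bar>a (k + 1) - a k - M\<bar>"
      by (intro tendsto_intros a)
  qed (use A in blast)
  moreover have "dist (\<phi> (a k + t) y) (\<phi> t (x k)) \<le> 3 * \<eta> + 2 * \<omega>"
    if "0 \<le> t" "t \<le> M" for k t
  proof (rule LIMSEQ_le_const2)
    show "(\<lambda>n. dist (\<phi> (A (r n) k + t) (Y (r n))) (\<phi> t (x k))) \<longlonglongrightarrow>
        dist (\<phi> (a k + t) y) (\<phi> t (x k))"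
      by (intro tendsto_intros a Yr)
    have "dist (\<phi> (A (r n) k + t) (Y (r n))) (\<phi> t (x k)) \<le> 3 * \<eta> + 2 * \<omega>"
      if "n \<ge> nat (\<bar>k\<bar> + 1)" for n
    proof (rule Y)
      have "n \<le> r n" by (rule seq_suble[OF r])
      then show "- int (r n) \<le> k" "k < int (r n)" using that by auto
    qed fact+
    then show "\<exists>N. \<forall>n\<ge>N. dist (\<phi> (A (r n) k + t) (Y (r n))) (\<phi> t (x k)) \<le> 3 * \<eta> + 2 * \<omega>"
      by blast
  qed
  ultimately show ?thesis by (intro exI[of _ y] exI[of _ a]) auto
qed

end

section \<open>Reparametrizations\<close>

text \<open>
  Used both for the jump times of a pseudo orbit and for the surjectivity of a reparametrization.
\<close>

lemma bi_infinite_partition: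
  fixes a :: "int \<Rightarrow> real"
  assumes "c > 0" and gap: "\<And>k. a (k + 1) - a k \<ge> c"
  shows "\<exists>k. a k \<le> r \<and> r < a (k + 1)"
proof -
  have grow: "a k + of_nat n * c \<le> a (k + int n)" for k n
  proof (induction n)
    case (Suc n)
    then show ?case using gap[of "k + int n"] by (simp add: algebra_simps)
  qed simp
  define n where "n = nat \<lceil>(\<bar>r\<bar> + \<bar>a 0\<bar>) / c\<rceil> + 1"
  have "(\<bar>r\<bar> + \<bar>a 0\<bar>) / c < real n"
    unfolding n_def by linarith
  then have n: "\<bar>r\<bar> + \<bar>a 0\<bar> < real n * c" using \<open>c > 0\<close> by (simp add: field_simps)
  have "\<exists>k. a k \<le> r \<and> r < a (k + 1)" if "a k \<le> r" "r < a (k + int m)" for k m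
    using that
  proof (induction m)
    case (Suc m)
    show ?case
    proof (cases "r < a (k + int m)")
      case False
      then show ?thesis using Suc.prems by (intro exI[of _ "k + int m"]) (simp add: algebra_simps)
    qed (use Suc in blast)
  qed simp
  moreover have "a (- int n) \<le> r" "r < a (- int n + int (2 * n))"
    using grow[of "- int n" n] grow[of 0 n] n by auto
  ultimately show ?thesis by blast
qed

text \<open>
  The interpolation has slope \<open>(a\<^bsub>k+1\<^esub> - a\<^sub>k) / M\<close> on the interval \<open>[kM, (k+1)M]\<close>. The time error on that
  interval is at most the error of one increment, however large \<open>k\<close> and \<open>M\<close> are.
\<close>

lemma piecewise_linear_reparametrization:
  fixes a :: "int \<Rightarrow> real"
  assumes "0 \<le> \<eta>" "\<eta> < M" and a0: "a 0 = 0" and gap: "\<And>k. \<bar>a (k + 1) - a k - M\<bar> \<le> \<eta>"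
  shows "\<exists>\<rho>. strict_mono \<rho> \<and> surj \<rho> \<and> \<rho> 0 = 0 \<and> (\<forall>k. \<rho> (of_int k * M) = a k) \<and>
    (\<forall>k t. 0 \<le> t \<and> t \<le> M \<longrightarrow> \<bar>\<rho> (of_int k * M + t) - a k - t\<bar> \<le> \<eta>)"
proof -
  have M: "M > 0" using assms by simp
  have gap_pos: "a (k + 1) - a k \<ge> M - \<eta>" for k using gap[of k] by simp
  have mono_nat: "a k \<le> a (k + int n)" for k n
  proof (induction n)
    case (Suc n)
    then show ?case using gap_pos[of "k + int n"] \<open>\<eta> < M\<close> by (simp add: algebra_simps)
  qed simp
  have mono: "a k \<le> a l" if "k \<le> l" for k l
    using mono_nat[of k "nat (l - k)"] that by simp
  \<comment> \<open>The interpolation with nodes at the integers; \<open>\<rho>\<close> below rescales the nodes to the multiples of \<open>M\<close>.\<close>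
  define g where "g u = a \<lfloor>u\<rfloor> + frac u * (a (\<lfloor>u\<rfloor> + 1) - a \<lfloor>u\<rfloor>)" for u :: real
  have g_int: "g (of_int k) = a k" for k by (simp add: g_def)
  have g_eq: "g (of_int k + v) = a k + v * (a (k + 1) - a k)" if "0 \<le> v" "v \<le> 1" for k v
  proof (cases "v = 1")
    case True
    then show ?thesis using g_int[of "k + 1"] by simp
  next
    case False
    then have "\<lfloor>of_int k + v\<rfloor> = k" "frac (of_int k + v) = v"
      using that by (auto simp: floor_eq_iff frac_eq frac_def)
    then show ?thesis by (simp add: g_def)
  qed
  have g_lower: "a \<lfloor>u\<rfloor> \<le> g u" for u
    using gap_pos[of "\<lfloor>u\<rfloor>"] \<open>\<eta> < M\<close> by (simp add: g_def)
  have g_upper: "g u < a (\<lfloor>u\<rfloor> + 1)" for u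
  proof -
    have "frac u * (a (\<lfloor>u\<rfloor> + 1) - a \<lfloor>u\<rfloor>) < 1 * (a (\<lfloor>u\<rfloor> + 1) - a \<lfloor>u\<rfloor>)"
      using gap_pos[of "\<lfloor>u\<rfloor>"] \<open>\<eta> < M\<close> frac_lt_1[of u] by (intro mult_strict_right_mono) auto
    then show ?thesis by (simp add: g_def)
  qed
  have g_mono: "g u < g v" if "u < v" for u v
  proof (cases "\<lfloor>u\<rfloor> = \<lfloor>v\<rfloor>")
    case True
    then have "frac u < frac v" using that by (simp add: frac_def)
    then have "frac u * (a (\<lfloor>u\<rfloor> + 1) - a \<lfloor>u\<rfloor>) < frac v * (a (\<lfloor>u\<rfloor> + 1) - a \<lfloor>u\<rfloor>)"
      using gap_pos[of "\<lfloor>u\<rfloor>"] \<open>\<eta> < M\<close> by (intro mult_strict_right_mono) auto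
    then show ?thesis using True by (simp add: g_def)
  next
    case False
    then have "\<lfloor>u\<rfloor> + 1 \<le> \<lfloor>v\<rfloor>" using floor_mono[of u v] that by linarith
    then show ?thesis using g_upper[of u] g_lower[of v] mono by fastforce
  qed
  have g_surj: "\<exists>u. g u = r" for r
  proof -
    obtain k where k: "a k \<le> r" "r < a (k + 1)"
      using bi_infinite_partition[of "M - \<eta>" a r] gap_pos \<open>\<eta> < M\<close> by auto
    define v where "v = (r - a k) / (a (k + 1) - a k)"
    have "0 \<le> v" "v \<le> 1" using k by (auto simp: v_def field_simps)
    then have "g (of_int k + v) = r" using g_eq k by (simp add: v_def)
    then show ?thesis ..
  qed
  define \<rho> where "\<rho> s = g (s / M)" for s
  have "strict_mono \<rho>"
    using g_mono M by (auto simp: \<rho>_def strict_mono_def divide_strict_right_mono)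
  moreover have "surj \<rho>"
    unfolding surj_def
  proof
    fix r
    obtain u where "g u = r" using g_surj by blast
    then show "\<exists>s. r = \<rho> s" using M by (intro exI[of _ "u * M"]) (simp add: \<rho>_def)
  qed
  moreover have nodes: "\<rho> (of_int k * M) = a k" for k
    using M g_int by (simp add: \<rho>_def)
  moreover have "\<rho> 0 = 0" using nodes[of 0] a0 by simp
  moreover have "\<bar>\<rho> (of_int k * M + t) - a k - t\<bar> \<le> \<eta>" if t: "0 \<le> t" "t \<le> M" for k t
  proof -
    have "\<rho> (of_int k * M + t) = a k + t / M * (a (k + 1) - a k)"
      using g_eq[of "t / M" k] t M by (simp add: \<rho>_def add_divide_distrib)
    then have "\<rho> (of_int k * M + t) - a k - t = t / M * (a (k + 1) - a k - M)"
      using M by (simp add: field_simps)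
    then have "\<bar>\<rho> (of_int k * M + t) - a k - t\<bar> = t / M * \<bar>a (k + 1) - a k - M\<bar>"
      using t M by (simp add: abs_mult)
    also have "\<dots> \<le> 1 * \<eta>"
      using gap t M by (intro mult_mono) auto
    finally show ?thesis by simp
  qed
  ultimately show ?thesis by (intro exI[of _ \<rho>]) auto
qed

lemma homeomorphism_if_strict_mono_surj:
  fixes \<rho> :: "real \<Rightarrow> real"
  assumes mono: "strict_mono \<rho>" and surj: "surj \<rho>"
  shows "homeomorphism UNIV UNIV \<rho> (inv \<rho>)"
proof -
  have inj: "inj \<rho>" using mono by (rule strict_mono_imp_inj_on)
  have "continuous_on UNIV \<rho>"
    using surj mono by (intro continuous_onI_mono) (auto simp: strict_mono_less_eq)
  moreover have "continuous_on UNIV (inv \<rho>)"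
  proof (rule continuous_onI_mono)
    show "open (range (inv \<rho>))" using inj by (simp add: inj_imp_surj_inv)
    show "inv \<rho> x \<le> inv \<rho> y" if "x \<le> y" for x y
      using that surj strict_mono_less_eq[OF mono, of "inv \<rho> x" "inv \<rho> y"]
      by (simp add: surj_f_inv_f)
  qed
  ultimately show ?thesis
    using surj inj by (auto simp: homeomorphism_def inj_imp_surj_inv surj_f_inv_f)
qed

text \<open>
  The main step. The bound \<open>\<delta>\<close> on the jumps is uniform in the length \<open>M\<close> of the segments,
  and the drift of the time change over one segment is at most \<open>\<epsilon>\<close>. Orbit closing needs both, since it
  regards a whole almost closed orbit as a single segment.
\<close>

lemma (in compact_flow) tracing:
  assumes "fixed_point_free \<phi>" "expansive \<phi>" "local_product_structure \<phi>" and "\<epsilon> > 0"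
  shows "\<exists>M\<^sub>0>0. \<exists>\<delta>>0. \<forall>M\<ge>M\<^sub>0. \<forall>x::int \<Rightarrow> 'a. (\<forall>k. dist (\<phi> M (x k)) (x (k + 1)) \<le> \<delta>) \<longrightarrow>
    (\<exists>y \<rho>. strict_mono \<rho> \<and> surj \<rho> \<and> \<rho> 0 = 0 \<and> (\<forall>k t. 0 \<le> t \<and> t \<le> M \<longrightarrow>
      dist (\<phi> (\<rho> (of_int k * M + t)) y) (\<phi> t (x k)) \<le> \<epsilon> \<and>
      \<bar>\<rho> (of_int k * M + t) - \<rho> (of_int k * M) - t\<bar> \<le> \<epsilon>))"
proof -
  interpret reverse: compact_flow "reverse_flow \<phi>" by (rule compact_flow_reverse)
  obtain \<alpha> where \<alpha>: "\<alpha> > 0" "\<And>\<epsilon>. \<epsilon> > 0 \<Longrightarrow> \<exists>T>0. \<forall>x y t. t \<ge> T \<longrightarrow>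
    (y \<in> local_stable_set \<phi> \<alpha> x \<longrightarrow> dist (\<phi> t y) (\<phi> t x) \<le> \<epsilon>) \<and>
    (y \<in> local_unstable_set \<phi> \<alpha> x \<longrightarrow> dist (\<phi> (- t) y) (\<phi> (- t) x) \<le> \<epsilon>)"
    using uniform_contraction_stable_unstable[OF assms(1-3)] by blast
  obtain e where e: "e > 0" "\<And>\<epsilon>. 0 < \<epsilon> \<Longrightarrow> \<epsilon> \<le> e \<Longrightarrow> local_product_structure_at \<phi> \<epsilon>"
    using assms(3) unfolding local_product_structure_def by blast
  obtain \<zeta> where \<zeta>: "\<zeta> > 0" "\<And>s t x. \<bar>s - t\<bar> \<le> \<zeta> \<Longrightarrow> dist (\<phi> s x) (\<phi> t x) \<le> \<epsilon> / 8"
    using flow_near_identity[of "\<epsilon> / 8"] \<open>\<epsilon> > 0\<close> by auto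
  \<comment> \<open>The chain is traced up to \<open>3\<eta> + 2\<epsilon>/8\<close>, and interpolating the times costs another \<open>\<epsilon>/8\<close>.\<close>
  define \<eta> where "\<eta> = Min {\<alpha> / 2, e, \<zeta> / 2, \<epsilon> / 8}"
  have \<eta>: "\<eta> > 0" "2 * \<eta> \<le> \<alpha>" "\<eta> \<le> e" "2 * \<eta> \<le> \<zeta>" "8 * \<eta> \<le> \<epsilon>"
    using \<alpha>(1) e(1) \<zeta>(1) \<open>\<epsilon> > 0\<close> by (auto simp: \<eta>_def min_def)
  obtain \<delta> where \<delta>: "\<delta> > 0" "\<And>x y. dist x y \<le> \<delta> \<Longrightarrow> \<exists>!\<tau>. \<bar>\<tau>\<bar> \<le> \<eta> \<and>
        (\<exists>z. local_stable_set \<phi> \<eta> (\<phi> \<tau> x) \<inter> local_unstable_set \<phi> \<eta> y = {z})"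
    using e(2)[OF \<eta>(1,3)] unfolding local_product_structure_at_def by blast
  obtain T where T: "T > 0" "\<And>x y t. t \<ge> T \<Longrightarrow> y \<in> local_stable_set \<phi> \<alpha> x \<Longrightarrow>
      dist (\<phi> t y) (\<phi> t x) \<le> min (\<delta> / 2) \<eta>"
    "\<And>x y t. t \<ge> T \<Longrightarrow> y \<in> local_unstable_set \<phi> \<alpha> x \<Longrightarrow>
      dist (\<phi> (- t) y) (\<phi> (- t) x) \<le> min (\<delta> / 2) \<eta>"
    using \<alpha>(2)[of "min (\<delta> / 2) \<eta>"] \<delta>(1) \<eta>(1) by auto
  show ?thesis
  proof (rule exI[of _ "T + \<eta>"], intro conjI, use T(1) \<eta>(1) in simp,
      rule exI[of _ "\<delta> / 2"], intro conjI allI impI)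
    show "\<delta> / 2 > 0" using \<delta>(1) by simp
    fix M :: real and x :: "int \<Rightarrow> 'a"
    assume M: "T + \<eta> \<le> M" and jump: "\<forall>k. dist (\<phi> M (x k)) (x (k + 1)) \<le> \<delta> / 2"
    interpret tracing_scales \<phi> \<eta> "\<epsilon> / 8" \<delta> T M
    proof
      show "\<exists>\<tau> z. \<bar>\<tau>\<bar> \<le> \<eta> \<and> z \<in> local_stable_set \<phi> \<eta> (\<phi> \<tau> x) \<and> z \<in> local_unstable_set \<phi> \<eta> y"
        if "dist x y \<le> \<delta>" for x y
        using \<delta>(2)[OF that] by blast
      show "dist (\<phi> t y) (\<phi> t x) \<le> \<delta> / 2" if "y \<in> local_stable_set \<phi> \<eta> x" "t \<ge> T" for x y t
        using T(2)[OF that(2) local_stable_set_mono[OF that(1)]] \<eta> by simp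
      show "dist (\<phi> (- t) y) (\<phi> (- t) x) \<le> \<eta>"
        if "y \<in> local_unstable_set \<phi> (2 * \<eta>) x" "t \<ge> T" for x y t
        using T(3)[OF that(2)] reverse.local_stable_set_mono[OF _ \<eta>(2)] that(1)
        by (simp add: local_unstable_set_def)
      show "dist (\<phi> s x) (\<phi> t x) \<le> \<epsilon> / 8" if "\<bar>s - t\<bar> \<le> 2 * \<eta>" for s t x
        using \<zeta>(2) that \<eta>(4) by simp
    qed (use \<eta> \<delta> T M in simp_all)
    obtain y a where a: "a 0 = 0" "\<And>k. \<bar>a (k + 1) - a k - M\<bar> \<le> \<eta>"
      and y: "\<And>k t. 0 \<le> t \<Longrightarrow> t \<le> M \<Longrightarrow>
        dist (\<phi> (a k + t) y) (\<phi> t (x k)) \<le> 3 * \<eta> + 2 * (\<epsilon> / 8)"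
      using chain_tracing[of x, OF jump[rule_format]] by blast
    obtain \<rho> where \<rho>: "strict_mono \<rho>" "surj \<rho>" "\<rho> 0 = 0" "\<And>k. \<rho> (of_int k * M) = a k"
      "\<And>k t. 0 \<le> t \<Longrightarrow> t \<le> M \<Longrightarrow> \<bar>\<rho> (of_int k * M + t) - a k - t\<bar> \<le> \<eta>"
      using piecewise_linear_reparametrization[of \<eta> M a] a M \<eta>(1) T(1) by auto
    have "dist (\<phi> (\<rho> (of_int k * M + t)) y) (\<phi> t (x k)) \<le> \<epsilon> \<and>
      \<bar>\<rho> (of_int k * M + t) - \<rho> (of_int k * M) - t\<bar> \<le> \<epsilon>" if t: "0 \<le> t" "t \<le> M" for k t
    proof
      have "dist (\<phi> (\<rho> (of_int k * M + t)) y) (\<phi> (a k + t) y) \<le> \<epsilon> / 8"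
        using \<rho>(5)[OF t, of k] \<eta> by (intro short_time) linarith
      then show "dist (\<phi> (\<rho> (of_int k * M + t)) y) (\<phi> t (x k)) \<le> \<epsilon>"
        using y[OF t, of k] \<eta>(5) \<open>\<epsilon> > 0\<close>
          dist_triangle[of "\<phi> (\<rho> (of_int k * M + t)) y" "\<phi> t (x k)" "\<phi> (a k + t) y"]
        by linarith
      show "\<bar>\<rho> (of_int k * M + t) - \<rho> (of_int k * M) - t\<bar> \<le> \<epsilon>"
        using \<rho>(4,5) t \<eta>(1,5) by (smt (verit))
    qed
    then show "\<exists>y \<rho>. strict_mono \<rho> \<and> surj \<rho> \<and> \<rho> 0 = 0 \<and> (\<forall>k t. 0 \<le> t \<and> t \<le> M \<longrightarrow>
      dist (\<phi> (\<rho> (of_int k * M + t)) y) (\<phi> t (x k)) \<le> \<epsilon> \<and>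
      \<bar>\<rho> (of_int k * M + t) - \<rho> (of_int k * M) - t\<bar> \<le> \<epsilon>)"
      using \<rho>(1-3) by blast
  qed
qed

section \<open>The jump times of a pseudo orbit\<close>

text \<open>
  Signed jump times merge the two one-sided sequences into a single increasing bi-infinite one. With
  them, both tracing conditions say that for all integers \<open>k\<close> the tracing orbit follows \<open>x\<^sub>k\<close> on the interval from
  \<open>jump_time \<tau> k\<close> to \<open>jump_time \<tau> (k + 1)\<close>.
\<close>

definition jump_time :: "(int \<Rightarrow> real) \<Rightarrow> int \<Rightarrow> real" where
  "jump_time \<tau> k = (if k \<ge> 0 then forward_time \<tau> (nat k) else - backward_time \<tau> (nat (- k)))"

lemma jump_time_nonneg: "jump_time \<tau> (int n) = forward_time \<tau> n"
  by (simp add: jump_time_def)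

lemma jump_time_nonpos: "jump_time \<tau> (- int n) = - backward_time \<tau> n"
  by (auto simp: jump_time_def forward_time_def backward_time_def)

lemma jump_time_step: "jump_time \<tau> (k + 1) = jump_time \<tau> k + \<tau> k"
proof (cases "k \<ge> 0")
  case True
  then obtain n where k: "k = int n" by (metis nonneg_int_cases)
  have "jump_time \<tau> (k + 1) = forward_time \<tau> (Suc n)"
    using jump_time_nonneg[of \<tau> "Suc n"] by (simp add: k add.commute)
  then show ?thesis by (simp add: k jump_time_nonneg forward_time_def)
next
  case False
  then obtain n where k: "k = - int (Suc n)"
    by (metis linorder_not_le negD)
  have "jump_time \<tau> (k + 1) = - backward_time \<tau> n"
    using jump_time_nonpos[of \<tau> n] by (simp add: k)
  moreover have "jump_time \<tau> k = - backward_time \<tau> (Suc n)"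
    using jump_time_nonpos[of \<tau> "Suc n"] by (simp add: k)
  ultimately show ?thesis by (simp add: k backward_time_def)
qed

lemma jump_time_mono:
  assumes "\<And>k. \<tau> k \<ge> 0" "k \<le> l"
  shows "jump_time \<tau> k \<le> jump_time \<tau> l"
  using assms(2)
proof (induction l rule: int_ge_induct)
  case (step i)
  then show ?case using jump_time_step[of \<tau> i] assms(1)[of i] by simp
qed simp

context compact_flow
begin

text \<open>
  Over a bounded time a pseudo orbit makes a bounded number of jumps, so it stays close to a true
  orbit if the jumps are small. The induction advances by the time \<open>T\<close>, during which there is at most one
  jump. This compares the pseudo orbit with the flow from any starting time \<open>s\<close>, so that it can be
  sampled at equidistant times, whatever the sizes of the \<open>\<tau>\<^sub>k\<close>.
\<close>

lemma pseudo_orbit_follows_flow: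
  fixes n :: nat
  assumes "T > 0" "\<epsilon> > 0"
  shows "\<exists>\<delta>>0. \<forall>x \<tau> k l s t. pseudo_orbit \<phi> \<delta> T x \<tau> \<longrightarrow>
    jump_time \<tau> k \<le> s \<and> s < jump_time \<tau> (k + 1) \<longrightarrow> 0 \<le> t \<and> t \<le> of_nat n * T \<longrightarrow>
    jump_time \<tau> l \<le> s + t \<and> s + t < jump_time \<tau> (l + 1) \<longrightarrow>
    dist (\<phi> (s + t - jump_time \<tau> k) (x k)) (\<phi> (s + t - jump_time \<tau> l) (x l)) \<le> \<epsilon>"
  using \<open>\<epsilon> > 0\<close>
proof (induction n arbitrary: \<epsilon>)
  case 0
  have "k = l" if "pseudo_orbit \<phi> 1 T x \<tau>" "jump_time \<tau> k \<le> s" "s < jump_time \<tau> (k + 1)"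
    "jump_time \<tau> l \<le> s" "s < jump_time \<tau> (l + 1)" for x \<tau> k l s
  proof -
    have \<tau>: "\<tau> j \<ge> 0" for j
      using that(1) \<open>T > 0\<close> unfolding pseudo_orbit_def by (meson less_imp_le order_trans)
    have "\<not> k + 1 \<le> l" "\<not> l + 1 \<le> k"
      using jump_time_mono[of \<tau> "k + 1" l, OF \<tau>] jump_time_mono[of \<tau> "l + 1" k, OF \<tau>] that
      by linarith+
    then show "k = l" by linarith
  qed
  then show ?case using 0 by (intro exI[of _ 1]) fastforce
next
  case (Suc n)
  obtain \<gamma> where \<gamma>: "\<gamma> > 0" "\<And>x y t. \<bar>t\<bar> \<le> T \<Longrightarrow> dist x y \<le> \<gamma> \<Longrightarrow> dist (\<phi> t x) (\<phi> t y) \<le> \<epsilon> / 2"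
    using uniformly_continuous_flow[of "\<epsilon> / 2" T] \<open>\<epsilon> > 0\<close>
    by (metis abs_zero diff_self half_gt_zero less_imp_le)
  obtain \<delta> where \<delta>: "\<delta> > 0" "\<And>x \<tau> k l s t. pseudo_orbit \<phi> \<delta> T x \<tau> \<Longrightarrow>
    jump_time \<tau> k \<le> s \<Longrightarrow> s < jump_time \<tau> (k + 1) \<Longrightarrow> 0 \<le> t \<Longrightarrow> t \<le> of_nat n * T \<Longrightarrow>
    jump_time \<tau> l \<le> s + t \<Longrightarrow> s + t < jump_time \<tau> (l + 1) \<Longrightarrow>
    dist (\<phi> (s + t - jump_time \<tau> k) (x k)) (\<phi> (s + t - jump_time \<tau> l) (x l)) \<le> \<gamma>"
    using Suc.IH[OF \<gamma>(1)] by blast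
  have "dist (\<phi> (s + t - jump_time \<tau> k) (x k)) (\<phi> (s + t - jump_time \<tau> l) (x l)) \<le> \<epsilon>"
    if po: "pseudo_orbit \<phi> (min \<delta> \<gamma>) T x \<tau>"
      and k: "jump_time \<tau> k \<le> s" "s < jump_time \<tau> (k + 1)"
      and t: "0 \<le> t" "t \<le> of_nat (Suc n) * T"
      and l: "jump_time \<tau> l \<le> s + t" "s + t < jump_time \<tau> (l + 1)" for x \<tau> k l s t
  proof -
    have \<tau>: "\<tau> j \<ge> T" and jump: "dist (\<phi> (\<tau> j) (x j)) (x (j + 1)) \<le> \<gamma>" for j
      using po by (auto simp: pseudo_orbit_def)
    have \<tau>0: "\<tau> j \<ge> 0" for j using \<tau>[of j] \<open>T > 0\<close> by simp
    \<comment> \<open>The maximum covers the times below \<open>T\<close>, where the remaining time must not become negative.\<close>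
    define t1 where "t1 = max 0 (t - T)"
    define u where "u = t - t1"
    have t1: "0 \<le> t1" "t1 \<le> of_nat n * T" and u: "0 \<le> u" "u \<le> T" "t = t1 + u"
      using t \<open>T > 0\<close> by (auto simp: t1_def u_def algebra_simps)
    obtain m where m: "jump_time \<tau> m \<le> s + t1" "s + t1 < jump_time \<tau> (m + 1)"
      using bi_infinite_partition[of T "jump_time \<tau>" "s + t1"] \<tau> \<open>T > 0\<close>
      by (auto simp: jump_time_step)
    have "pseudo_orbit \<phi> \<delta> T x \<tau>" using po by (auto simp: pseudo_orbit_def)
    from \<delta>(2)[OF this k t1 m]
    have "dist (\<phi> u (\<phi> (s + t1 - jump_time \<tau> k) (x k))) (\<phi> u (\<phi> (s + t1 - jump_time \<tau> m) (x m))) \<le> \<epsilon> / 2"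
      using u by (intro \<gamma>(2)) auto
    then have 1: "dist (\<phi> (s + t - jump_time \<tau> k) (x k)) (\<phi> (s + t - jump_time \<tau> m) (x m)) \<le> \<epsilon> / 2"
      by (simp add: u(3) algebra_simps)
    have "\<not> l + 1 \<le> m" using jump_time_mono[of \<tau> "l + 1" m, OF \<tau>0] m l u by linarith
    moreover have "\<not> m + 1 + 1 \<le> l"
      using jump_time_mono[of \<tau> "m + 1 + 1" l, OF \<tau>0] jump_time_step[of \<tau> "m + 1"]
        \<tau>[of "m + 1"] m l u by linarith
    ultimately consider "l = m" | "l = m + 1" by linarith
    then have "dist (\<phi> (s + t - jump_time \<tau> m) (x m)) (\<phi> (s + t - jump_time \<tau> l) (x l)) \<le> \<epsilon> / 2"
    proof cases
      case 1
      then show ?thesis using \<open>\<epsilon> > 0\<close> by simp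
    next
      case 2
      have "dist (\<phi> (s + t - jump_time \<tau> l) (\<phi> (\<tau> m) (x m))) (\<phi> (s + t - jump_time \<tau> l) (x l)) \<le> \<epsilon> / 2"
        using jump[of m] m l u by (intro \<gamma>(2)) (auto simp: 2)
      moreover have "s + t - jump_time \<tau> m = s + t - jump_time \<tau> l + \<tau> m"
        by (simp add: 2 jump_time_step)
      ultimately show ?thesis by (simp only: flow_flow)
    qed
    then show ?thesis
      using 1 dist_triangle[of "\<phi> (s + t - jump_time \<tau> k) (x k)" "\<phi> (s + t - jump_time \<tau> l) (x l)"
        "\<phi> (s + t - jump_time \<tau> m) (x m)"] by linarith
  qed
  then show ?case using \<delta>(1) \<gamma>(1) by (intro exI[of _ "min \<delta> \<gamma>"]) auto
qed

section \<open>Pseudo-orbit tracing and orbit closing\<close>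

text \<open>
  Sampling the pseudo orbit at the multiples of the length \<open>M\<close> gives a chain of segments of equal
  length with small jumps. Between the sampling times the pseudo orbit is close to the segments, so an
  orbit that traces the chain also traces the pseudo orbit.
\<close>

lemma pseudo_orbit_tracing:
  assumes "fixed_point_free \<phi>" "expansive \<phi>" "local_product_structure \<phi>"
  shows "pseudo_orbit_tracing_property \<phi>"
  unfolding pseudo_orbit_tracing_property_def
proof (intro allI impI)
  fix \<epsilon> T :: real assume "\<epsilon> > 0" "T > 0"
  obtain M \<delta>\<^sub>0 where M: "M > 0" and \<delta>\<^sub>0: "\<delta>\<^sub>0 > 0"
    and tracing: "\<And>x::int \<Rightarrow> 'a. (\<And>k. dist (\<phi> M (x k)) (x (k + 1)) \<le> \<delta>\<^sub>0) \<Longrightarrow>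
    \<exists>y \<rho>. strict_mono \<rho> \<and> surj \<rho> \<and> \<rho> 0 = 0 \<and> (\<forall>k t. 0 \<le> t \<and> t \<le> M \<longrightarrow>
      dist (\<phi> (\<rho> (of_int k * M + t)) y) (\<phi> t (x k)) \<le> \<epsilon> / 2)"
    using tracing[OF assms, of "\<epsilon> / 2"] \<open>\<epsilon> > 0\<close> by (metis half_gt_zero order_refl)
  define n where "n = nat \<lceil>M / T\<rceil>"
  have "M / T \<le> real n" unfolding n_def by linarith
  then have n: "M \<le> of_nat n * T" using \<open>T > 0\<close> by (simp add: field_simps)
  obtain \<delta> where \<delta>: "\<delta> > 0" "\<And>x \<tau> k l s t. pseudo_orbit \<phi> \<delta> T x \<tau> \<Longrightarrow>
    jump_time \<tau> k \<le> s \<Longrightarrow> s < jump_time \<tau> (k + 1) \<Longrightarrow> 0 \<le> t \<Longrightarrow> t \<le> of_nat n * T \<Longrightarrow>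
    jump_time \<tau> l \<le> s + t \<Longrightarrow> s + t < jump_time \<tau> (l + 1) \<Longrightarrow>
    dist (\<phi> (s + t - jump_time \<tau> k) (x k)) (\<phi> (s + t - jump_time \<tau> l) (x l)) \<le> min \<delta>\<^sub>0 (\<epsilon> / 2)"
    using pseudo_orbit_follows_flow[OF \<open>T > 0\<close>, of "min \<delta>\<^sub>0 (\<epsilon> / 2)" n] \<delta>\<^sub>0 \<open>\<epsilon> > 0\<close>
    by (metis half_gt_zero min_less_iff_conj)
  have "\<exists>y. traced_by \<phi> \<epsilon> x \<tau> y" if po: "pseudo_orbit \<phi> \<delta> T x \<tau>" for x \<tau>
  proof -
    have "\<tau> k \<ge> T" for k using po by (simp add: pseudo_orbit_def)
    then have "\<exists>k. jump_time \<tau> k \<le> s \<and> s < jump_time \<tau> (k + 1)" for s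
      using bi_infinite_partition[of T "jump_time \<tau>" s] \<open>T > 0\<close> by (simp add: jump_time_step)
    then obtain p where p: "\<And>s. jump_time \<tau> (p s) \<le> s" "\<And>s. s < jump_time \<tau> (p s + 1)"
      by metis
    define X where "X j = \<phi> (of_int j * M - jump_time \<tau> (p (of_int j * M))) (x (p (of_int j * M)))"
      for j :: int
    have X: "dist (\<phi> t (X j)) (\<phi> (s - jump_time \<tau> l) (x l)) \<le> min \<delta>\<^sub>0 (\<epsilon> / 2)"
      if "s = of_int j * M + t" "0 \<le> t" "t \<le> M" "jump_time \<tau> l \<le> s" "s < jump_time \<tau> (l + 1)"
      for j l :: int and s t :: real
      using \<delta>(2)[OF po p[of "of_int j * M"] that(2), of l] that n
      by (simp add: X_def algebra_simps)
    have "dist (\<phi> M (X j)) (X (j + 1)) \<le> min \<delta>\<^sub>0 (\<epsilon> / 2)" for j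
      unfolding X_def[of "j + 1"] using M p by (intro X) (simp_all add: algebra_simps)
    then have "dist (\<phi> M (X j)) (X (j + 1)) \<le> \<delta>\<^sub>0" for j by simp
    then obtain y \<rho> where \<rho>: "strict_mono \<rho>" "surj \<rho>" "\<rho> 0 = 0"
      and y: "\<And>k t. 0 \<le> t \<Longrightarrow> t \<le> M \<Longrightarrow> dist (\<phi> (\<rho> (of_int k * M + t)) y) (\<phi> t (X k)) \<le> \<epsilon> / 2"
      using tracing[of X] by blast
    have traced: "dist (\<phi> (\<rho> s) y) (\<phi> (s - jump_time \<tau> l) (x l)) \<le> \<epsilon>"
      if l: "jump_time \<tau> l \<le> s" "s < jump_time \<tau> (l + 1)" for s l
    proof -
      define j where "j = \<lfloor>s / M\<rfloor>"
      define t where "t = s - of_int j * M"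
      have "of_int j \<le> s / M" "s / M < of_int j + 1" by (simp_all add: j_def)
      then have t: "0 \<le> t" "t \<le> M" "s = of_int j * M + t"
        using M by (auto simp: t_def field_simps)
      show ?thesis
        using y[OF t(1,2), of j] X[OF t(3,1,2) l] t(3)
          dist_triangle[of "\<phi> (\<rho> s) y" "\<phi> (s - jump_time \<tau> l) (x l)" "\<phi> t (X j)"]
        by simp
    qed
    have hom: "homeomorphism UNIV UNIV \<rho> (inv \<rho>)"
      by (rule homeomorphism_if_strict_mono_surj[OF \<rho>(1,2)])
    have "traced_by \<phi> \<epsilon> x \<tau> y"
      unfolding traced_by_def
    proof (intro exI[of _ \<rho>] conjI allI impI)
      show "continuous_on UNIV \<rho>" "continuous_on (range \<rho>) (inv \<rho>)"
        using hom \<rho>(2) by (simp_all add: homeomorphism_def)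
      show "dist (\<phi> (\<rho> s) y) (\<phi> (s - forward_time \<tau> k) (x (int k))) \<le> \<epsilon>"
        if "forward_time \<tau> k \<le> s \<and> s < forward_time \<tau> (k + 1)" for k s
        using traced[of "int k" s] that jump_time_nonneg[of \<tau> "Suc k"]
        by (simp add: jump_time_nonneg add.commute)
      show "dist (\<phi> (\<rho> s) y) (\<phi> (s + backward_time \<tau> k) (x (- int k))) \<le> \<epsilon>"
        if "k \<ge> 1" "- backward_time \<tau> k \<le> s \<and> s < - backward_time \<tau> (k - 1)" for k s
        using traced[of "- int k" s] that jump_time_nonpos[of \<tau> "k - 1"]
        by (simp add: jump_time_nonpos of_nat_diff)
    qed (use \<rho> in auto)
    then show ?thesis ..
  qed
  then show "\<exists>\<delta>>0. \<forall>x \<tau>. pseudo_orbit \<phi> \<delta> T x \<tau> \<longrightarrow> (\<exists>y. traced_by \<phi> \<epsilon> x \<tau> y)"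
    using \<delta>(1) by blast
qed

text \<open>
  Trace the constant chain \<open>x\<^sub>k = x\<close> with segments of length \<open>t\<close> by the orbit of \<open>y\<close>. The point \<open>w = \<phi>\<^bsup>\<rho>(t)\<^esup>(y)\<close>
  traces the same chain, shifted by one place, so the orbits of \<open>w\<close> and \<open>y\<close> are close up to a time change, and
  expansivity puts \<open>w\<close> on the orbit of \<open>y\<close> at a small time \<open>u\<close>. Thus \<open>y\<close> has the period \<open>\<rho>(t) - u\<close>.
\<close>

lemma orbit_closing:
  assumes "fixed_point_free \<phi>" "expansive \<phi>" "local_product_structure \<phi>"
  shows "orbit_closing_property \<phi>"
  unfolding orbit_closing_property_def
proof (intro allI impI)
  fix \<epsilon> :: real assume "\<epsilon> > 0"
  obtain c where c: "c > 0" "\<And>x y \<rho> \<rho>' :: real \<Rightarrow> real. homeomorphism UNIV UNIV \<rho> \<rho>' \<Longrightarrow>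
      strict_mono \<rho> \<Longrightarrow> \<rho> 0 = 0 \<Longrightarrow> (\<And>t. dist (\<phi> (\<rho> t) y) (\<phi> t x) \<le> c) \<Longrightarrow>
      \<exists>u. \<bar>u\<bar> \<le> \<epsilon> / 2 \<and> y = \<phi> u x"
    using assms(2) \<open>\<epsilon> > 0\<close> unfolding expansive_def by (metis half_gt_zero)
  obtain \<zeta> where \<zeta>: "\<zeta> > 0" "\<And>s t x. \<bar>s - t\<bar> \<le> \<zeta> \<Longrightarrow> dist (\<phi> s x) (\<phi> t x) \<le> \<epsilon> / 2"
    using flow_near_identity[of "\<epsilon> / 2"] \<open>\<epsilon> > 0\<close> by auto
  define \<gamma> where "\<gamma> = Min {\<epsilon> / 2, c / 2, \<zeta>}"
  have \<gamma>: "\<gamma> > 0" "\<gamma> \<le> \<epsilon> / 2" "\<gamma> \<le> c / 2" "\<gamma> \<le> \<zeta>"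
    using c(1) \<zeta>(1) \<open>\<epsilon> > 0\<close> by (auto simp: \<gamma>_def)
  obtain M\<^sub>0 \<delta> where M\<^sub>0: "M\<^sub>0 > 0" and \<delta>: "\<delta> > 0"
    and tracing: "\<And>M x. M \<ge> M\<^sub>0 \<Longrightarrow> (\<And>k. dist (\<phi> M (x k)) (x (k + 1)) \<le> \<delta>) \<Longrightarrow>
    \<exists>y \<rho>. strict_mono \<rho> \<and> surj \<rho> \<and> \<rho> 0 = 0 \<and> (\<forall>k::int. \<forall>t. 0 \<le> t \<and> t \<le> M \<longrightarrow>
      dist (\<phi> (\<rho> (of_int k * M + t)) y) (\<phi> t (x k)) \<le> \<gamma> \<and>
      \<bar>\<rho> (of_int k * M + t) - \<rho> (of_int k * M) - t\<bar> \<le> \<gamma>)"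
    using tracing[OF assms \<gamma>(1)] by metis
  \<comment> \<open>The summand \<open>\<epsilon>\<close> in the lower bound for \<open>t\<close> keeps the period positive.\<close>
  have "\<exists>y l. l > 0 \<and> \<bar>l - t\<bar> \<le> \<epsilon> \<and> \<phi> l y = y \<and>
      (\<forall>s. 0 \<le> s \<and> s \<le> min t l \<longrightarrow> dist (\<phi> s x) (\<phi> s y) \<le> \<epsilon>)"
    if t: "t > M\<^sub>0 + \<epsilon>" and x: "dist x (\<phi> t x) \<le> \<delta>" for x t
  proof -
    have t0: "t > 0" "t \<ge> M\<^sub>0" using t M\<^sub>0 \<open>\<epsilon> > 0\<close> by auto
    obtain y \<rho> where \<rho>: "strict_mono \<rho>" "surj \<rho>" "\<rho> 0 = 0"
      and y: "\<And>(k::int) s. 0 \<le> s \<Longrightarrow> s \<le> t \<Longrightarrow> dist (\<phi> (\<rho> (of_int k * t + s)) y) (\<phi> s x) \<le> \<gamma>"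
      and drift: "\<And>(k::int) s. 0 \<le> s \<Longrightarrow> s \<le> t \<Longrightarrow> \<bar>\<rho> (of_int k * t + s) - \<rho> (of_int k * t) - s\<bar> \<le> \<gamma>"
      using tracing[OF t0(2), of "\<lambda>_. x"] x by (subst (asm) dist_commute) blast
    define w where "w = \<phi> (\<rho> t) y"
    \<comment> \<open>Go back from the clock of \<open>y\<close> to that of the chain, advance by one segment, and return.\<close>
    define h where "h s = \<rho> (inv \<rho> s + t) - \<rho> t" for s
    have "inj \<rho>" using \<rho>(1) by (rule strict_mono_imp_inj_on)
    then have inv_\<rho>: "\<rho> (inv \<rho> s) = s" "inv \<rho> (\<rho> s) = s" for s
      using \<rho>(2) by (simp_all add: surj_f_inv_f)
    have "inv \<rho> r < inv \<rho> s" if "r < s" for r s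
      using that inv_\<rho>(1) strict_mono_less[OF \<rho>(1)] by metis
    then have h_mono: "strict_mono h"
      using strict_monoD[OF \<rho>(1)] by (simp add: h_def strict_mono_def)
    have h_surj: "surj h"
      by (rule surjI[where f = "\<lambda>s. \<rho> (inv \<rho> (s + \<rho> t) - t)"]) (simp add: h_def inv_\<rho>)
    have h0: "h 0 = 0" using inv_\<rho>(2)[of 0] by (simp add: h_def \<rho>(3))
    have "dist (\<phi> (h s) w) (\<phi> s y) \<le> c" for s
    proof -
      define k where "k = \<lfloor>inv \<rho> s / t\<rfloor>"
      define r where "r = inv \<rho> s - of_int k * t"
      have "of_int k \<le> inv \<rho> s / t" "inv \<rho> s / t < of_int k + 1" by (simp_all add: k_def)
      then have r: "0 \<le> r" "r \<le> t" using t0 by (auto simp: r_def field_simps)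
      have "dist (\<phi> s y) (\<phi> r x) \<le> \<gamma>"
        using y[OF r, of k] by (simp add: r_def inv_\<rho>)
      moreover have "dist (\<phi> (h s) w) (\<phi> r x) \<le> \<gamma>"
        using y[OF r, of "k + 1"] by (simp add: r_def h_def w_def algebra_simps)
      ultimately show ?thesis
        using \<gamma>(3) dist_triangle2[of "\<phi> (h s) w" "\<phi> s y" "\<phi> r x"] by linarith
    qed
    then obtain u where u: "\<bar>u\<bar> \<le> \<epsilon> / 2" "w = \<phi> u y"
      using c(2)[OF homeomorphism_if_strict_mono_surj[OF h_mono h_surj] h_mono h0] by blast
    define l where "l = \<rho> t - u"
    have drift0: "\<bar>\<rho> s - s\<bar> \<le> \<gamma>" if "0 \<le> s" "s \<le> t" for s
      using drift[OF that, of 0] \<rho>(3) by simp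
    have l: "\<bar>l - t\<bar> \<le> \<epsilon>" using drift0[of t] t0 \<gamma>(2) u(1) by (simp add: l_def)
    have "\<phi> l y = \<phi> (- u) w" by (simp add: l_def w_def)
    then have "\<phi> l y = y" using u(2) by simp
    moreover have "dist (\<phi> s x) (\<phi> s y) \<le> \<epsilon>" if s: "0 \<le> s" "s \<le> t" for s
    proof -
      have "dist (\<phi> (\<rho> s) y) (\<phi> s x) \<le> \<gamma>" using y[OF s, of 0] by simp
      moreover have "dist (\<phi> (\<rho> s) y) (\<phi> s y) \<le> \<epsilon> / 2"
        using \<zeta>(2) drift0[OF s] \<gamma>(4) by simp
      ultimately show ?thesis
        using \<gamma>(2) dist_triangle3[of "\<phi> s x" "\<phi> s y" "\<phi> (\<rho> s) y"] by linarith
    qed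
    moreover have "l > 0" using l t M\<^sub>0 by linarith
    ultimately show ?thesis using l by (intro exI[of _ y] exI[of _ l]) auto
  qed
  then show "\<exists>\<delta>>0. \<exists>T>0. \<forall>x t. t > T \<and> dist x (\<phi> t x) \<le> \<delta> \<longrightarrow>
        (\<exists>y l. l > 0 \<and> \<bar>l - t\<bar> \<le> \<epsilon> \<and> \<phi> l y = y \<and>
           (\<forall>s. 0 \<le> s \<and> s \<le> min t l \<longrightarrow> dist (\<phi> s x) (\<phi> s y) \<le> \<epsilon>))"
    using \<delta> M\<^sub>0 \<open>\<epsilon> > 0\<close> by (intro exI[of _ \<delta>] conjI exI[of _ "M\<^sub>0 + \<epsilon>"]) auto
qed

end

theorem theorem4:
  fixes \<phi> :: "real \<Rightarrow> 'a::metric_space \<Rightarrow> 'a"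
  assumes "compact (UNIV :: 'a set)"
    and "continuous_flow \<phi>"
    and "fixed_point_free \<phi>"
    and "expansive \<phi>"
    and "local_product_structure \<phi>"
  shows "pseudo_orbit_tracing_property \<phi> \<and> orbit_closing_property \<phi>"
proof -
  interpret compact_flow \<phi> by unfold_locales fact+
  show ?thesis using assms(3-5) pseudo_orbit_tracing orbit_closing by blast
qed

end
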